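(* Let $\mathcal{A}_{\gamma\delta}$ and $\mathcal{P}_{\gamma\delta}$ be the block matrices $$\mathcal{A}_{\gamma\delta}=\begin{bmatrix}A_{\gamma\delta}&B^T&C^T\\ B&0&0\\ C&0&0\end{bmatrix},\qquad \mathcal{P}_{\gamma\delta}=\begin{bmatrix}A_{\gamma\delta}&B^T&C^T\\ 0&-\frac1\gamma Q&0\\ 0&0&-\frac1\delta W\end{bmatrix},\qquad A_{\gamma\delta}=A+\gamma B^TQ^{-1}B+\delta C^TW^{-1}C.$$ The non-zero eigenvalues of $\mathcal{P}_{\gamma\delta}^{-1}\mathcal{A}_{\gamma\delta}$ are all real and positive. More precisely, letting $(x;y;z)$ be an eigenvector of $\mathcal{P}_{\gamma\delta}^{-1}\mathcal{A}_{\gamma\delta}$, it holds $$\operatorname{Spec}(\mathcal{P}_{\gamma\delta}^{-1}\mathcal{A}_{\gamma\delta})\setminus\{0\}\subseteq[\min(\eta,\epsilon,\theta),1],$$ where $$\eta=\min\left\{\frac{\gamma\, x^TB^TQ^{-1}Bx}{x^T(A+\gamma B^TQ^{-1}B)x}\ \Big|\ x\in\ker(C)\setminus\ker(B)\right\},$$ $$\epsilon=\min\left\{\frac{\delta\, x^TC^TW^{-1}Cx}{x^T(A+\delta C^TW^{-1}C)x}\ \Big|\ x\in\ker(B)\setminus\ker(C)\right\},$$ $$\theta=\min\left\{\frac{x^T(\gamma B^TQ^{-1}B+\delta C^TW^{-1}C)x}{x^T(A+\gamma B^TQ^{-1}B+\delta C^TW^{-1}C)x}\ \Big|\ x\notin\ker(B)\cup\ker(C)\right\},$$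 and with $\lambda=1$ being an eigenvalue of $\mathcal{P}_{\gamma\delta}^{-1}\mathcal{A}_{\gamma\delta}$ of algebraic multiplicity at least $n$.
   Context: Here $A\in\mathbb{R}^{n\times n}$ is symmetric positive definite, $B\in\mathbb{R}^{m\times n}$ is rank deficient by 1 (rank $m-1$), $C\in\mathbb{R}^{l\times n}$ has full row rank, $Q\in\mathbb{R}^{m\times m}$ and $W\in\mathbb{R}^{l\times l}$ are arbitrary symmetric positive definite matrices, and $\gamma>0$, $\delta>0$ are real parameters. $\operatorname{Spec}(M)$ denotes the spectrum of a square matrix $M$. Vectors of size $n+m+l$ are written in block form $(x;y;z)$ with blocks of sizes $n$, $m$, $l$; the vector $x$ in the definitions of $\eta,\epsilon,\theta$ is the first block of an eigenvector $(x;y;z)$. Because $B$ is rank deficient, $0$ is an eigenvalue of $\mathcal{P}_{\gamma\delta}^{-1}\mathcal{A}_{\gamma\delta}$. *)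

theory Defs
  imports
    "HOL-Library.Extended_Real"
    "Jordan_Normal_Form.Spectral_Radius"
    "Jordan_Normal_Form.DL_Rank"
    "Jordan_Normal_Form.Gauss_Jordan_Elimination"
    "Jordan_Normal_Form.Matrix_Kernel"
begin

definition sym_pos_def :: "nat \<Rightarrow> real mat \<Rightarrow> bool" where
  "sym_pos_def k M \<longleftrightarrow> M \<in> carrier_mat k k \<and> transpose_mat M = M \<and>
     (\<forall>x \<in> carrier_vec k. x \<noteq> 0\<^sub>v k \<longrightarrow> x \<bullet> (M *\<^sub>v x) > 0)"

text \<open>The value is unspecified for singular matrices; it is only applied to invertible ones.\<close>

definition mat_inv :: "'a::field mat \<Rightarrow> 'a mat" where
  "mat_inv M = the (mat_inverse M)"

lemma mat_inv:
  assumes M: "M \<in> carrier_mat k k" and inv: "invertible_mat M"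
  shows "mat_inv M \<in> carrier_mat k k" "M * mat_inv M = 1\<^sub>m k" "mat_inv M * M = 1\<^sub>m k"
proof -
  from inv obtain N where N: "M * N = 1\<^sub>m k" "N * M = 1\<^sub>m (dim_row N)"
    using M unfolding invertible_mat_def inverts_mat_def by auto
  have "dim_col N = dim_col (M * N)" by simp
  then have c: "dim_col N = k" using N(1) by simp
  have "dim_row N = dim_col (N * M)" using N(2) by simp
  then have "N \<in> carrier_mat k k" using c M by auto
  then have "M \<in> Units (ring_mat TYPE('a) k ())"
    using M N unfolding Units_def by (auto simp: ring_mat_simps)
  then obtain N' where "mat_inverse M = Some N'"
    using mat_inverse(1)[OF M, of "()"] by (cases "mat_inverse M") auto
  then show "mat_inv M \<in> carrier_mat k k" "M * mat_inv M = 1\<^sub>m k" "mat_inv M * M = 1\<^sub>m k"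
    using mat_inverse(2)[OF M] unfolding mat_inv_def by auto
qed

definition append_cols :: "'a::zero mat \<Rightarrow> 'a mat \<Rightarrow> 'a mat" (infixr "@\<^sub>c" 66) where
  "M @\<^sub>c N = four_block_mat M N (0\<^sub>m 0 (dim_col M)) (0\<^sub>m 0 (dim_col N))"

definition aug_block ::
  "real \<Rightarrow> real \<Rightarrow> real mat \<Rightarrow> real mat \<Rightarrow> real mat \<Rightarrow> real mat \<Rightarrow> real mat \<Rightarrow> real mat" where
  "aug_block \<gamma> \<delta> A B C Q W =
     A + \<gamma> \<cdot>\<^sub>m (transpose_mat B * mat_inv Q * B) + \<delta> \<cdot>\<^sub>m (transpose_mat C * mat_inv W * C)"

definition saddle_mat ::
  "real \<Rightarrow> real \<Rightarrow> real mat \<Rightarrow> real mat \<Rightarrow> real mat \<Rightarrow> real mat \<Rightarrow> real mat \<Rightarrow> real mat" where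
  "saddle_mat \<gamma> \<delta> A B C Q W = (let m = dim_row B; l = dim_row C in
     (aug_block \<gamma> \<delta> A B C Q W @\<^sub>c transpose_mat B @\<^sub>c transpose_mat C) @\<^sub>r
     (B                        @\<^sub>c 0\<^sub>m m m         @\<^sub>c 0\<^sub>m m l) @\<^sub>r
     (C                        @\<^sub>c 0\<^sub>m l m         @\<^sub>c 0\<^sub>m l l))"

definition precond_mat ::
  "real \<Rightarrow> real \<Rightarrow> real mat \<Rightarrow> real mat \<Rightarrow> real mat \<Rightarrow> real mat \<Rightarrow> real mat \<Rightarrow> real mat" where
  "precond_mat \<gamma> \<delta> A B C Q W = (let n = dim_row A; m = dim_row B; l = dim_row C in
     (aug_block \<gamma> \<delta> A B C Q W @\<^sub>c transpose_mat B     @\<^sub>c transpose_mat C) @\<^sub>r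
     (0\<^sub>m m n                   @\<^sub>c (- (1 / \<gamma>)) \<cdot>\<^sub>m Q @\<^sub>c 0\<^sub>m m l) @\<^sub>r
     (0\<^sub>m l n                   @\<^sub>c 0\<^sub>m l m             @\<^sub>c (- (1 / \<delta>)) \<cdot>\<^sub>m W))"

definition precond_saddle_mat ::
  "real \<Rightarrow> real \<Rightarrow> real mat \<Rightarrow> real mat \<Rightarrow> real mat \<Rightarrow> real mat \<Rightarrow> real mat \<Rightarrow> real mat" where
  "precond_saddle_mat \<gamma> \<delta> A B C Q W =
     mat_inv (precond_mat \<gamma> \<delta> A B C Q W) * saddle_mat \<gamma> \<delta> A B C Q W"

text \<open>A real matrix need not have a real spectrum, so eigenvalues are taken over the complex
  numbers.\<close>

definition Spec :: "real mat \<Rightarrow> complex set" where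
  "Spec M = spectrum (map_mat complex_of_real M)"

text \<open>The first blocks of the eigenvectors \<open>(x; y; z)\<close> of \<open>M\<close> belonging to an eigenvalue in
  \<open>\<Lambda>\<close>.\<close>

definition eigvec_blocks :: "nat \<Rightarrow> nat \<Rightarrow> nat \<Rightarrow> real mat \<Rightarrow> real set \<Rightarrow> real vec set" where
  "eigvec_blocks n m l M \<Lambda> =
     {x \<in> carrier_vec n. \<exists>y \<in> carrier_vec m. \<exists>z \<in> carrier_vec l. \<exists>\<mu> \<in> \<Lambda>.
        eigenvector M (x @\<^sub>v y @\<^sub>v z) \<mu>}"

text \<open>The sets of quotients over which \<open>\<eta>\<close>, \<open>\<epsilon>\<close>, \<open>\<theta>\<close> are the minima, for \<open>x\<close> ranging
  over \<open>X\<close>.\<close>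

definition eta_set ::
  "real vec set \<Rightarrow> real \<Rightarrow> real mat \<Rightarrow> real mat \<Rightarrow> real mat \<Rightarrow> real mat \<Rightarrow> real set" where
  "eta_set X \<gamma> A B C Q =
     {\<gamma> * (x \<bullet> (transpose_mat B * mat_inv Q * B *\<^sub>v x)) /
        (x \<bullet> ((A + \<gamma> \<cdot>\<^sub>m (transpose_mat B * mat_inv Q * B)) *\<^sub>v x))
      | x. x \<in> X \<and> x \<in> mat_kernel C - mat_kernel B}"

definition epsilon_set ::
  "real vec set \<Rightarrow> real \<Rightarrow> real mat \<Rightarrow> real mat \<Rightarrow> real mat \<Rightarrow> real mat \<Rightarrow> real set" where
  "epsilon_set X \<delta> A B C W =
     {\<delta> * (x \<bullet> (transpose_mat C * mat_inv W * C *\<^sub>v x)) /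
        (x \<bullet> ((A + \<delta> \<cdot>\<^sub>m (transpose_mat C * mat_inv W * C)) *\<^sub>v x))
      | x. x \<in> X \<and> x \<in> mat_kernel B - mat_kernel C}"

definition theta_set ::
  "real vec set \<Rightarrow> real \<Rightarrow> real \<Rightarrow> real mat \<Rightarrow> real mat \<Rightarrow> real mat \<Rightarrow> real mat \<Rightarrow> real mat
     \<Rightarrow> real set" where
  "theta_set X \<gamma> \<delta> A B C Q W =
     {(x \<bullet> ((\<gamma> \<cdot>\<^sub>m (transpose_mat B * mat_inv Q * B)
               + \<delta> \<cdot>\<^sub>m (transpose_mat C * mat_inv W * C)) *\<^sub>v x)) /
        (x \<bullet> (aug_block \<gamma> \<delta> A B C Q W *\<^sub>v x))
      | x. x \<in> X \<and> x \<notin> mat_kernel B \<union> mat_kernel C}"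

text \<open>The minimum of a set of reals if there is one. It is the infimum in general, so the minimum
  over an empty set is \<open>\<infinity>\<close> and such a set does not contribute to \<open>min(\<eta>, \<epsilon>, \<theta>)\<close>.\<close>

definition ext_min :: "real set \<Rightarrow> ereal" where
  "ext_min S = Inf (ereal ` S)"

definition lower_bound ::
  "real vec set \<Rightarrow> real \<Rightarrow> real \<Rightarrow> real mat \<Rightarrow> real mat \<Rightarrow> real mat \<Rightarrow> real mat \<Rightarrow> real mat
     \<Rightarrow> ereal" where
  "lower_bound X \<gamma> \<delta> A B C Q W =
     min (ext_min (eta_set X \<gamma> A B C Q))
       (min (ext_min (epsilon_set X \<delta> A B C W)) (ext_min (theta_set X \<gamma> \<delta> A B C Q W)))"

definition has_min :: "real set \<Rightarrow> bool" where
  "has_min S \<longleftrightarrow> (\<exists>a \<in> S. \<forall>b \<in> S. a \<le> b)"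

end

theory Submission
  imports Defs
begin

text \<open>Write \<open>T = P\<^sup>-\<^sup>1S\<close>, \<open>G = A\<^sub>\<gamma>\<^sub>\<delta>\<close> and \<open>E = G - A\<close>. An eigenvector \<open>(x; y; z)\<close> of \<open>T\<close> for \<open>\<mu>\<close> solves
  \<open>S v = \<mu> P v\<close>. As \<open>S\<close> and \<open>P\<close> share their first block row, this row vanishes on the
  eigenvector unless \<open>\<mu> = 1\<close>; eliminating \<open>y\<close> and \<open>z\<close> by means of the other two rows leaves
  \<open>\<mu> G x = E x\<close>. Hence \<open>\<mu>\<close> is the generalised Rayleigh quotient of \<open>x\<close>, which coincides with the
  quotient in the definition of \<open>\<eta>\<close>, \<open>\<epsilon>\<close> or \<open>\<theta>\<close> according to the kernels that contain \<open>x\<close>, and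
  is less than 1 because \<open>A\<close> is positive definite. That the minimum of these quotients also bounds
  the eigenvalue 1 rests on the existence of a non-zero eigenvalue of the pencil \<open>(E, G)\<close>,
  which follows from \<open>C \<noteq> 0\<close>.\<close>

section \<open>Kernels, products with vectors and bilinear forms of matrices\<close>

lemma invertible_mat_if_kernel_trivial:
  fixes M :: "'a::field mat"
  assumes M: "M \<in> carrier_mat k k"
    and ker: "\<And>v. v \<in> carrier_vec k \<Longrightarrow> M *\<^sub>v v = 0\<^sub>v k \<Longrightarrow> v = 0\<^sub>v k"
  shows "invertible_mat M"
proof -
  have "det M \<noteq> 0"
    using det_0_iff_vec_prod_zero_field[OF M] ker by blast
  then obtain N where "N \<in> carrier_mat k k" "N * M = 1\<^sub>m k" "M * N = 1\<^sub>m k"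
    using det_non_zero_imp_unit[OF M, of "()"] unfolding Units_def
    by (auto simp: ring_mat_simps)
  then show ?thesis
    using M unfolding invertible_mat_def inverts_mat_def square_mat.simps by auto
qed

lemma eq_zero_mat_if_mult_vec_zero:
  fixes M :: "'a::semiring_1 mat"
  assumes M: "M \<in> carrier_mat r k"
    and zero: "\<And>v. v \<in> carrier_vec k \<Longrightarrow> M *\<^sub>v v = 0\<^sub>v r"
  shows "M = 0\<^sub>m r k"
proof (rule eq_matI)
  fix i j assume "i < dim_row (0\<^sub>m r k :: 'a mat)" "j < dim_col (0\<^sub>m r k :: 'a mat)"
  then have ij: "i < r" "j < k" by auto
  have "(M *\<^sub>v unit_vec k j) $ i = M $$ (i, j)"
    using M ij by simp
  then show "M $$ (i, j) = 0\<^sub>m r k $$ (i, j)"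
    using zero[of "unit_vec k j"] ij by simp
qed (use M in auto)

lemma mult_mat_zero_vec:
  fixes M :: "'a::semiring_0 mat"
  assumes "M \<in> carrier_mat r k"
  shows "M *\<^sub>v 0\<^sub>v k = 0\<^sub>v r"
  using assms by (intro eq_vecI) auto

lemma zero_mult_vec:
  fixes v :: "'a::semiring_0 vec"
  shows "v \<in> carrier_vec k \<Longrightarrow> 0\<^sub>m r k *\<^sub>v v = 0\<^sub>v r"
  by (intro eq_vecI) auto

lemma sym_bilinear:
  fixes M :: "'a::comm_semiring_0 mat"
  assumes M: "M \<in> carrier_mat k k" "transpose_mat M = M"
    and xy: "x \<in> carrier_vec k" "y \<in> carrier_vec k"
  shows "x \<bullet> (M *\<^sub>v y) = y \<bullet> (M *\<^sub>v x)"
  using transpose_vec_mult_scalar[OF M(1) xy(2,1)] M xy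
  by (metis comm_scalar_prod mult_mat_vec_carrier)

text \<open>The transpose of \<open>B\<close> moves across the scalar product. Symmetry and
  non-negativity of the form of \<open>R\<close> thereby carry over to the congruent matrix.\<close>

lemma quadratic_form_congruence:
  fixes B :: "'a::comm_semiring_0 mat"
  assumes B: "B \<in> carrier_mat m n" and R: "R \<in> carrier_mat m m"
    and xy: "x \<in> carrier_vec n" "y \<in> carrier_vec n"
  shows "x \<bullet> (transpose_mat B * R * B *\<^sub>v y) = (B *\<^sub>v x) \<bullet> (R *\<^sub>v (B *\<^sub>v y))"
proof -
  have By: "R *\<^sub>v (B *\<^sub>v y) \<in> carrier_vec m" using B R xy by auto
  have "transpose_mat B * R * B *\<^sub>v y = transpose_mat B *\<^sub>v (R *\<^sub>v (B *\<^sub>v y))"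
    using B R xy by (simp add: assoc_mult_mat_vec[of _ n m] assoc_mult_mat_vec[of _ n m _ n])
  then show ?thesis
    using transpose_vec_mult_scalar[OF B xy(1) By] B R xy By
    by (metis comm_scalar_prod mult_mat_vec_carrier transpose_carrier_mat)
qed

section \<open>Symmetric positive definite matrices and their inverses\<close>

context
  fixes k :: nat and M :: "real mat"
  assumes spd: "sym_pos_def k M"
begin

lemma sym_pos_def_carrier: "M \<in> carrier_mat k k"
  and sym_pos_def_transpose: "transpose_mat M = M"
  using spd unfolding sym_pos_def_def by auto

lemma sym_pos_def_pos: "x \<in> carrier_vec k \<Longrightarrow> x \<noteq> 0\<^sub>v k \<Longrightarrow> 0 < x \<bullet> (M *\<^sub>v x)"
  using spd unfolding sym_pos_def_def by auto

lemma sym_pos_def_nonneg: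
  assumes "x \<in> carrier_vec k"
  shows "0 \<le> x \<bullet> (M *\<^sub>v x)"
proof (cases "x = 0\<^sub>v k")
  case True
  then show ?thesis using sym_pos_def_carrier by simp
qed (use sym_pos_def_pos[OF assms] in simp)

lemma sym_pos_def_eq_zero_iff:
  assumes "x \<in> carrier_vec k"
  shows "x \<bullet> (M *\<^sub>v x) = 0 \<longleftrightarrow> x = 0\<^sub>v k"
  using sym_pos_def_pos[OF assms] sym_pos_def_carrier assms by fastforce

lemma sym_pos_def_invertible: "invertible_mat M"
proof (rule invertible_mat_if_kernel_trivial[OF sym_pos_def_carrier])
  fix v assume "v \<in> carrier_vec k" "M *\<^sub>v v = 0\<^sub>v k"
  then show "v = 0\<^sub>v k" using sym_pos_def_eq_zero_iff[of v] by simp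
qed

lemmas sym_pos_def_mat_inv = mat_inv[OF sym_pos_def_carrier sym_pos_def_invertible]

lemma sym_pos_def_mult_mat_inv_vec:
  assumes "x \<in> carrier_vec k"
  shows "M *\<^sub>v (mat_inv M *\<^sub>v x) = x" "mat_inv M *\<^sub>v (M *\<^sub>v x) = x"
  using sym_pos_def_mat_inv sym_pos_def_carrier assms
  by (simp_all flip: assoc_mult_mat_vec[of _ k k])

text \<open>As \<open>M\<close> is symmetric, the transposed inverse is a left inverse of
  \<open>M\<close> and so coincides with the inverse. For definiteness the substitution
  \<open>x = M u\<close> turns the form of the inverse at \<open>x\<close> into the form of
  \<open>M\<close> at \<open>u\<close>.\<close>

lemma sym_pos_def_inverse: "sym_pos_def k (mat_inv M)"
proof -
  note I = sym_pos_def_mat_inv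
  let ?T = "transpose_mat (mat_inv M)"
  have "?T * M = 1\<^sub>m k"
    using arg_cong[OF I(2), of transpose_mat] transpose_mult[OF sym_pos_def_carrier I(1)]
    by (simp add: sym_pos_def_transpose)
  then have "1\<^sub>m k * mat_inv M = ?T * M * mat_inv M" by simp
  also have "\<dots> = ?T * (M * mat_inv M)"
    using I(1) sym_pos_def_carrier by (intro assoc_mult_mat) auto
  finally have "?T = mat_inv M" using I by simp
  moreover have "0 < x \<bullet> (mat_inv M *\<^sub>v x)" if x: "x \<in> carrier_vec k" "x \<noteq> 0\<^sub>v k" for x
  proof -
    define u where "u = mat_inv M *\<^sub>v x"
    have u: "u \<in> carrier_vec k" using I x unfolding u_def by auto
    have Mu: "M *\<^sub>v u = x" unfolding u_def using sym_pos_def_mult_mat_inv_vec x by simp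
    then have "u \<noteq> 0\<^sub>v k" using x sym_pos_def_carrier by auto
    then have "0 < u \<bullet> (M *\<^sub>v u)" using sym_pos_def_pos u by blast
    then show ?thesis
      using comm_scalar_prod[OF x(1) u] unfolding Mu by (simp add: u_def)
  qed
  ultimately show ?thesis using I unfolding sym_pos_def_def by blast
qed

end

section \<open>Complex eigenvalues of real matrices, nilpotency and symmetric pencils\<close>

lemma complex_eigenvalue_real_parts:
  fixes M :: "real mat"
  assumes M: "M \<in> carrier_mat k k" and ev: "eigenvalue (map_mat complex_of_real M) \<mu>"
  obtains p q where "p \<in> carrier_vec k" "q \<in> carrier_vec k" "p \<noteq> 0\<^sub>v k \<or> q \<noteq> 0\<^sub>v k"
    "M *\<^sub>v p = Re \<mu> \<cdot>\<^sub>v p + (- Im \<mu>) \<cdot>\<^sub>v q" "M *\<^sub>v q = Im \<mu> \<cdot>\<^sub>v p + Re \<mu> \<cdot>\<^sub>v q"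
proof -
  from ev M obtain v where v: "v \<in> carrier_vec k" "v \<noteq> 0\<^sub>v k"
    and eq: "map_mat complex_of_real M *\<^sub>v v = \<mu> \<cdot>\<^sub>v v"
    unfolding eigenvalue_def eigenvector_def by auto
  \<comment> \<open>The eigenvector is \<open>v = p + i q\<close>; as \<open>M\<close> is real, the
    two claimed equations are the real and imaginary parts of \<open>M v = \<mu> v\<close>.\<close>
  define p where "p = map_vec Re v"
  define q where "q = map_vec Im v"
  have pq: "p \<in> carrier_vec k" "q \<in> carrier_vec k" using v unfolding p_def q_def by auto
  have eq_i: "(\<Sum>j<k. complex_of_real (M $$ (i, j)) * v $ j) = \<mu> * v $ i" if "i < k" for i
    using arg_cong[OF eq, of "\<lambda>w. w $ i"] that M v
    by (simp add: scalar_prod_def lessThan_atLeast0)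
  have "M *\<^sub>v p = Re \<mu> \<cdot>\<^sub>v p + (- Im \<mu>) \<cdot>\<^sub>v q"
  proof (rule eq_vecI)
    fix i assume "i < dim_vec (Re \<mu> \<cdot>\<^sub>v p + (- Im \<mu>) \<cdot>\<^sub>v q)"
    then have i: "i < k" using pq by simp
    show "(M *\<^sub>v p) $ i = (Re \<mu> \<cdot>\<^sub>v p + (- Im \<mu>) \<cdot>\<^sub>v q) $ i"
      using arg_cong[OF eq_i[OF i], of Re] i M v unfolding p_def q_def
      by (simp add: scalar_prod_def lessThan_atLeast0)
  qed (use M pq in auto)
  moreover have "M *\<^sub>v q = Im \<mu> \<cdot>\<^sub>v p + Re \<mu> \<cdot>\<^sub>v q"
  proof (rule eq_vecI)
    fix i assume "i < dim_vec (Im \<mu> \<cdot>\<^sub>v p + Re \<mu> \<cdot>\<^sub>v q)"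
    then have i: "i < k" using pq by simp
    show "(M *\<^sub>v q) $ i = (Im \<mu> \<cdot>\<^sub>v p + Re \<mu> \<cdot>\<^sub>v q) $ i"
      using arg_cong[OF eq_i[OF i], of Im] i M v unfolding p_def q_def
      by (simp add: scalar_prod_def lessThan_atLeast0)
  qed (use M pq in auto)
  moreover have "p \<noteq> 0\<^sub>v k \<or> q \<noteq> 0\<^sub>v k"
  proof (rule ccontr)
    assume "\<not> ?thesis"
    then have "p $ i = 0" "q $ i = 0" if "i < k" for i using that by auto
    then have "v = 0\<^sub>v k"
      using v by (intro eq_vecI) (auto simp: p_def q_def complex_eq_iff)
    with v show False by simp
  qed
  ultimately show thesis using that pq by blast
qed

lemma strictly_upper_triangular_nilpotent:
  fixes U :: "'a::semiring_1 mat"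
  assumes U: "U \<in> carrier_mat n n"
    and upper: "\<And>i j. j \<le> i \<Longrightarrow> i < n \<Longrightarrow> U $$ (i, j) = 0"
  shows "U ^\<^sub>m n = 0\<^sub>m n n"
proof -
  \<comment> \<open>Each further factor moves the non-zero entries one diagonal to the right. At
    \<open>k = n\<close> the condition \<open>j < i + k\<close> covers the whole matrix.\<close>
  have "(U ^\<^sub>m k) $$ (i, j) = 0" if "i < n" "j < n" "j < i + k" for i j k
    using that
  proof (induction k arbitrary: j)
    case 0
    then show ?case using U by simp
  next
    case (Suc k)
    \<comment> \<open>If \<open>t < i + k\<close>, the first factor vanishes by induction; otherwise
      \<open>j \<le> i + k \<le> t\<close>, and the second vanishes by strict triangularity.\<close>
    have "(U ^\<^sub>m k) $$ (i, t) * U $$ (t, j) = 0" if "t < n" for t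
      using Suc.IH[OF Suc.prems(1) that] upper[of j t] Suc.prems that by (cases "t < i + k") auto
    then show ?case
      using U Suc.prems pow_carrier_mat[OF U, of k] by (simp add: scalar_prod_def)
  qed
  then show ?thesis using pow_carrier_mat[OF U, of n] by (intro eq_matI) auto
qed

text \<open>The Schur form \<open>U\<close> is upper triangular and carries the eigenvalues of
  \<open>M\<close> on its diagonal. If these are all zero, \<open>U\<close> is strictly upper
  triangular, and nilpotency passes back along the similarity.\<close>

lemma nilpotent_if_spectrum_zero:
  fixes M :: "complex mat"
  assumes M: "M \<in> carrier_mat n n" and zero: "\<And>\<mu>. eigenvalue M \<mu> \<Longrightarrow> \<mu> = 0"
  shows "M ^\<^sub>m n = 0\<^sub>m n n"
proof -
  from char_poly_factorized[OF M] schur_decomposition_exists[OF M]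
  obtain U where U: "U \<in> carrier_mat n n" and upper: "upper_triangular U" and sim: "similar_mat M U"
    by blast
  have "U $$ (i, j) = 0" if "j \<le> i" "i < n" for i j
  proof (cases "j = i")
    case True
    have "poly (char_poly U) (U $$ (i, i)) = 0"
      using U that unfolding char_poly_upper_triangular[OF U upper] poly_prod_list prod_list_zero_iff
      by (auto simp: diag_mat_def image_iff intro!: bexI[of _ i])
    then have "eigenvalue M (U $$ (i, i))"
      using char_poly_similar[OF sim] eigenvalue_root_char_poly[OF M] by simp
    then show ?thesis using zero True by blast
  next
    case False
    then show ?thesis using upper_triangularD[OF upper, of j i] U that by auto
  qed
  then have "U ^\<^sub>m n = 0\<^sub>m n n"
    using strictly_upper_triangular_nilpotent[OF U] by blast
  moreover obtain P Q where wit: "similar_mat_wit M U P Q"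
    using sim unfolding similar_mat_def by blast
  moreover note similar_mat_witD2(6,7)[OF M wit]
  ultimately show ?thesis using similar_mat_wit_pow_id[OF wit, of n] by simp
qed

text \<open>With respect to the inner product of \<open>G\<close> the matrix \<open>G\<^sup>-\<^sup>1E\<close> is self-adjoint, so it
  can only be nilpotent if it vanishes.\<close>

lemma pencil_nonzero_eigenvalue:
  fixes G E :: "real mat"
  assumes G: "sym_pos_def n G" and E: "E \<in> carrier_mat n n" "transpose_mat E = E"
    and nz: "E \<noteq> 0\<^sub>m n n"
  obtains r x where "r \<noteq> 0" "x \<in> carrier_vec n" "x \<noteq> 0\<^sub>v n" "E *\<^sub>v x = r \<cdot>\<^sub>v (G *\<^sub>v x)"
proof -
  note Gc = sym_pos_def_carrier[OF G] and Gt = sym_pos_def_transpose[OF G]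
  note I = sym_pos_def_mat_inv[OF G]
  define N where "N = mat_inv G * E"
  have N: "N \<in> carrier_mat n n" unfolding N_def using I E by simp
  have GN: "G *\<^sub>v (N *\<^sub>v v) = E *\<^sub>v v" if "v \<in> carrier_vec n" for v
    using that E I sym_pos_def_mult_mat_inv_vec[OF G, of "E *\<^sub>v v"] unfolding N_def
    by (simp add: assoc_mult_mat_vec[of _ n n])
  have "\<exists>\<mu>. eigenvalue (map_mat complex_of_real N) \<mu> \<and> \<mu> \<noteq> 0"
  proof (rule ccontr)
    assume "\<not> ?thesis"
    then have "map_mat complex_of_real N ^\<^sub>m n = 0\<^sub>m n n"
      using N by (intro nilpotent_if_spectrum_zero) auto
    then have "map_mat complex_of_real (N ^\<^sub>m n) = 0\<^sub>m n n"
      using of_real_hom.mat_hom_pow[OF N, of n] by metis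
    then have nil: "N ^\<^sub>m n = 0\<^sub>m n n"
      using pow_carrier_mat[OF N, of n] by (auto simp: mat_eq_iff)
    \<comment> \<open>Self-adjointness: the squared \<open>G\<close>-norm of \<open>N w\<close>
      equals the \<open>G\<close>-product of \<open>w\<close> with \<open>N (N w)\<close>, so the
      kernel of the square of \<open>N\<close> is already the kernel of \<open>N\<close>.\<close>
    have step: "N *\<^sub>v w = 0\<^sub>v n" if w: "w \<in> carrier_vec n" "N *\<^sub>v (N *\<^sub>v w) = 0\<^sub>v n" for w
    proof -
      have Nw: "N *\<^sub>v w \<in> carrier_vec n" using N w by simp
      have "(N *\<^sub>v w) \<bullet> (G *\<^sub>v (N *\<^sub>v w)) = w \<bullet> (E *\<^sub>v (N *\<^sub>v w))"
        using GN[OF w(1)] sym_bilinear[OF E Nw w(1)] by simp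
      also have "\<dots> = w \<bullet> (G *\<^sub>v (N *\<^sub>v (N *\<^sub>v w)))" using GN[OF Nw] by simp
      also have "\<dots> = 0" using w Gc by (simp add: mult_mat_zero_vec)
      finally show ?thesis using sym_pos_def_eq_zero_iff[OF G Nw] by simp
    qed
    \<comment> \<open>Iterating \<open>step\<close> descends from the kernel of any power of
      \<open>N\<close> to the kernel of \<open>N\<close>. For \<open>k = 0\<close> the premise says
      \<open>v = 0\<close>.\<close>
    have zero: "N *\<^sub>v v = 0\<^sub>v n" if "N ^\<^sub>m k *\<^sub>v v = 0\<^sub>v n" "v \<in> carrier_vec n" for k v
      using that
    proof (induction k arbitrary: v)
      case 0
      then show ?case using N by (simp add: mult_mat_zero_vec)
    next
      case (Suc k)
      have "N *\<^sub>v (N *\<^sub>v v) = 0\<^sub>v n"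
        using Suc.prems N pow_carrier_mat[OF N, of k]
        by (intro Suc.IH) (simp_all add: assoc_mult_mat_vec[of _ n n])
      then show ?case using step Suc.prems by blast
    qed
    have "E *\<^sub>v v = 0\<^sub>v n" if v: "v \<in> carrier_vec n" for v
      using GN[OF v] zero[of n v] nil v Gc by (simp add: mult_mat_zero_vec zero_mult_vec)
    then have "E = 0\<^sub>m n n" using eq_zero_mat_if_mult_vec_zero[OF E(1)] by blast
    with nz show False ..
  qed
  then obtain \<mu> where \<mu>: "eigenvalue (map_mat complex_of_real N) \<mu>" "\<mu> \<noteq> 0" by blast
  obtain p q where pq: "p \<in> carrier_vec n" "q \<in> carrier_vec n" "p \<noteq> 0\<^sub>v n \<or> q \<noteq> 0\<^sub>v n"
    and Np: "N *\<^sub>v p = Re \<mu> \<cdot>\<^sub>v p + (- Im \<mu>) \<cdot>\<^sub>v q"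
    and Nq: "N *\<^sub>v q = Im \<mu> \<cdot>\<^sub>v p + Re \<mu> \<cdot>\<^sub>v q"
    using complex_eigenvalue_real_parts[OF N \<mu>(1)] by metis
  have Ep: "E *\<^sub>v p = Re \<mu> \<cdot>\<^sub>v (G *\<^sub>v p) + (- Im \<mu>) \<cdot>\<^sub>v (G *\<^sub>v q)"
    using GN[OF pq(1)] pq Gc unfolding Np
    by (simp add: mult_add_distrib_mat_vec[of _ n n] mult_mat_vec[of _ n n])
  have Eq: "E *\<^sub>v q = Im \<mu> \<cdot>\<^sub>v (G *\<^sub>v p) + Re \<mu> \<cdot>\<^sub>v (G *\<^sub>v q)"
    using GN[OF pq(2)] pq Gc unfolding Nq
    by (simp add: mult_add_distrib_mat_vec[of _ n n] mult_mat_vec[of _ n n])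
  \<comment> \<open>Pairing \<open>E p\<close> with \<open>q\<close> and \<open>E q\<close> with
    \<open>p\<close> gives equal numbers since \<open>E\<close> is symmetric. The
    \<open>Re \<mu>\<close> terms agree because \<open>G\<close> is symmetric, and what remains is
    this product.\<close>
  have "Im \<mu> * (p \<bullet> (G *\<^sub>v p) + q \<bullet> (G *\<^sub>v q)) = 0"
    using sym_bilinear[OF E pq(1,2)] sym_bilinear[OF Gc Gt pq(1,2)] pq Gc unfolding Ep Eq
    by (simp add: scalar_prod_add_distrib[of _ n] algebra_simps)
  moreover have "p \<bullet> (G *\<^sub>v p) + q \<bullet> (G *\<^sub>v q) > 0"
    using pq sym_pos_def_pos[OF G] sym_pos_def_nonneg[OF G]
    by (metis add_nonneg_pos add_pos_nonneg)
  ultimately have im: "Im \<mu> = 0" by simp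
  then have re: "Re \<mu> \<noteq> 0" using \<mu>(2) by (simp add: complex_eq_iff)
  have "E *\<^sub>v p = Re \<mu> \<cdot>\<^sub>v (G *\<^sub>v p)" "E *\<^sub>v q = Re \<mu> \<cdot>\<^sub>v (G *\<^sub>v q)"
    unfolding Ep Eq im using pq Gc by auto
  with pq re that show thesis by blast
qed

text \<open>The first \<open>n\<close> rows of \<open>M\<close> are rows of the identity, so the
  characteristic matrix is block lower triangular with \<open>X - 1\<close> times the identity as
  its upper left block. That block contributes the factor to the determinant.\<close>

lemma linear_power_dvd_char_poly:
  fixes M :: "'a::idom mat"
  assumes M: "M \<in> carrier_mat (n + k) (n + k)"
    and rows: "\<And>i j. i < n \<Longrightarrow> j < n + k \<Longrightarrow> M $$ (i, j) = (if i = j then 1 else 0)"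
  shows "[:-1, 1:] ^ n dvd char_poly M"
proof -
  define R where "R = mat k n (\<lambda>(i, j). char_poly_matrix M $$ (n + i, j))"
  define D where "D = mat k k (\<lambda>(i, j). char_poly_matrix M $$ (n + i, n + j))"
  have eq: "char_poly_matrix M = four_block_mat ([:-1, 1:] \<cdot>\<^sub>m 1\<^sub>m n) (0\<^sub>m n k) R D"
    using M rows by (intro eq_matI) (auto simp: char_poly_matrix_def R_def D_def one_pCons simp del: pCons_one)
  have "char_poly M = det ([:-1, 1:] \<cdot>\<^sub>m 1\<^sub>m n) * det D"
    unfolding char_poly_def eq
    by (rule det_four_block_mat_upper_right_zero[of _ n _ k]) (auto simp: R_def D_def)
  then show ?thesis by (simp add: det_smult)
qed

text \<open>Unit vectors recover the entries from the form. As the converse of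
  \<open>sym_bilinear\<close>, it yields the symmetry of \<open>E\<close> and \<open>G\<close> from
  their forms.\<close>

lemma transpose_eq_if_bilinear_sym:
  fixes M :: "'a::comm_semiring_1 mat"
  assumes M: "M \<in> carrier_mat k k"
    and sym: "\<And>x y. x \<in> carrier_vec k \<Longrightarrow> y \<in> carrier_vec k \<Longrightarrow> x \<bullet> (M *\<^sub>v y) = y \<bullet> (M *\<^sub>v x)"
  shows "transpose_mat M = M"
proof (rule eq_matI)
  fix i j assume "i < dim_row M" "j < dim_col M"
  then have ij: "i < k" "j < k" using M by auto
  have "unit_vec k a \<bullet> (M *\<^sub>v unit_vec k b) = M $$ (a, b)" if "a < k" "b < k" for a b
    using M that scalar_prod_left_unit[of "M *\<^sub>v unit_vec k b" k a] by simp
  then show "transpose_mat M $$ (i, j) = M $$ (i, j)"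
    using sym[of "unit_vec k i" "unit_vec k j"] ij M by simp
qed (use M in auto)

lemma smult_mat_mult_vec:
  fixes M :: "'a::comm_semiring_0 mat"
  assumes "M \<in> carrier_mat r k" "v \<in> carrier_vec k"
  shows "(a \<cdot>\<^sub>m M) *\<^sub>v v = a \<cdot>\<^sub>v (M *\<^sub>v v)"
  using assms by (intro eq_vecI) auto

section \<open>Block vectors and matrices appended side by side\<close>

lemma smult_append_vec: "a \<cdot>\<^sub>v (v @\<^sub>v w) = a \<cdot>\<^sub>v v @\<^sub>v a \<cdot>\<^sub>v w"
  by (intro eq_vecI) auto

lemma append_cols_carrier:
  assumes "M \<in> carrier_mat r c1" "N \<in> carrier_mat r c2"
  shows "M @\<^sub>c N \<in> carrier_mat r (c1 + c2)"
  using assms unfolding append_cols_def by auto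

lemma append_cols_mult_vec:
  fixes M N :: "'a::comm_semiring_0 mat"
  assumes M: "M \<in> carrier_mat r c1" and N: "N \<in> carrier_mat r c2"
    and v: "v \<in> carrier_vec c1" and w: "w \<in> carrier_vec c2"
  shows "(M @\<^sub>c N) *\<^sub>v (v @\<^sub>v w) = M *\<^sub>v v + N *\<^sub>v w"
proof -
  have "(M @\<^sub>c N) *\<^sub>v (v @\<^sub>v w)
    = (M *\<^sub>v v + N *\<^sub>v w) @\<^sub>v (0\<^sub>m 0 c1 *\<^sub>v v + 0\<^sub>m 0 c2 *\<^sub>v w)"
    using four_block_mat_mult_vec[OF M N _ _ v w, of "0\<^sub>m 0 c1" 0 "0\<^sub>m 0 c2"] M N
    unfolding append_cols_def by simp
  \<comment> \<open>The lower block row of the encoding has height 0, so the second part of the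
    appended vector is empty.\<close>
  also have "\<dots> = M *\<^sub>v v + N *\<^sub>v w" by (intro eq_vecI) auto
  finally show ?thesis .
qed

lemma append_vec_cases3:
  assumes "v \<in> carrier_vec (n + (m + l))"
  obtains x y z where "x \<in> carrier_vec n" "y \<in> carrier_vec m" "z \<in> carrier_vec l"
    "v = x @\<^sub>v y @\<^sub>v z"
  using vec_first_last_append[OF assms] vec_first_last_append[of "vec_last v (m + l)" m l]
  by (metis vec_first_carrier vec_last_carrier)

lemma append_vec3_eq_iff:
  assumes "x \<in> carrier_vec n" "x' \<in> carrier_vec n" "y \<in> carrier_vec m" "y' \<in> carrier_vec m"
  shows "x @\<^sub>v y @\<^sub>v z = x' @\<^sub>v y' @\<^sub>v z' \<longleftrightarrow> x = x' \<and> y = y' \<and> z = z'"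
  using assms by (simp add: append_vec_eq[of _ n] append_vec_eq[of _ m])

lemma zero_append_vec3: "0\<^sub>v (n + (m + l)) = 0\<^sub>v n @\<^sub>v 0\<^sub>v m @\<^sub>v 0\<^sub>v l"
  by (intro eq_vecI) auto

section \<open>The block matrices\<close>

locale double_saddle_point =
  fixes n m l :: nat and A B C Q W :: "real mat" and \<gamma> \<delta> :: real
  assumes A: "sym_pos_def n A"
    and B: "B \<in> carrier_mat m n" and C: "C \<in> carrier_mat l n" and C_nz: "C \<noteq> 0\<^sub>m l n"
    and Q: "sym_pos_def m Q" and W: "sym_pos_def l W"
    and \<gamma>: "\<gamma> > 0" and \<delta>: "\<delta> > 0"
begin

abbreviation "BQB \<equiv> transpose_mat B * mat_inv Q * B"
abbreviation "CWC \<equiv> transpose_mat C * mat_inv W * C"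
abbreviation "E \<equiv> \<gamma> \<cdot>\<^sub>m BQB + \<delta> \<cdot>\<^sub>m CWC"
abbreviation "G \<equiv> aug_block \<gamma> \<delta> A B C Q W"
abbreviation "P \<equiv> precond_mat \<gamma> \<delta> A B C Q W"
abbreviation "S \<equiv> saddle_mat \<gamma> \<delta> A B C Q W"
abbreviation "T \<equiv> precond_saddle_mat \<gamma> \<delta> A B C Q W"

lemma A_carrier: "A \<in> carrier_mat n n"
  and Q_carrier: "Q \<in> carrier_mat m m" and W_carrier: "W \<in> carrier_mat l l"
  using A Q W by (auto simp: sym_pos_def_def)

lemma inv_Q: "sym_pos_def m (mat_inv Q)" and inv_W: "sym_pos_def l (mat_inv W)"
  using Q W by (auto intro: sym_pos_def_inverse)

lemma inv_Q_carrier: "mat_inv Q \<in> carrier_mat m m" and inv_W_carrier: "mat_inv W \<in> carrier_mat l l"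
  using inv_Q inv_W by (auto simp: sym_pos_def_def)

lemma BQB_carrier: "BQB \<in> carrier_mat n n" and CWC_carrier: "CWC \<in> carrier_mat n n"
  using B C inv_Q_carrier inv_W_carrier by auto

lemma E_carrier: "E \<in> carrier_mat n n"
  using BQB_carrier CWC_carrier by auto

lemma G_carrier: "G \<in> carrier_mat n n"
  using A_carrier BQB_carrier CWC_carrier unfolding aug_block_def by auto

lemma BQB_form:
  "x \<in> carrier_vec n \<Longrightarrow> y \<in> carrier_vec n \<Longrightarrow>
    x \<bullet> (BQB *\<^sub>v y) = (B *\<^sub>v x) \<bullet> (mat_inv Q *\<^sub>v (B *\<^sub>v y))"
  by (rule quadratic_form_congruence[OF B inv_Q_carrier])

lemma CWC_form:
  "x \<in> carrier_vec n \<Longrightarrow> y \<in> carrier_vec n \<Longrightarrow>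
    x \<bullet> (CWC *\<^sub>v y) = (C *\<^sub>v x) \<bullet> (mat_inv W *\<^sub>v (C *\<^sub>v y))"
  by (rule quadratic_form_congruence[OF C inv_W_carrier])

lemma BQB_nonneg: "x \<in> carrier_vec n \<Longrightarrow> 0 \<le> x \<bullet> (BQB *\<^sub>v x)"
  using sym_pos_def_nonneg[OF inv_Q] B by (simp add: BQB_form)

lemma CWC_nonneg: "x \<in> carrier_vec n \<Longrightarrow> 0 \<le> x \<bullet> (CWC *\<^sub>v x)"
  using sym_pos_def_nonneg[OF inv_W] C by (simp add: CWC_form)

lemma E_vec:
  "x \<in> carrier_vec n \<Longrightarrow> E *\<^sub>v x = \<gamma> \<cdot>\<^sub>v (BQB *\<^sub>v x) + \<delta> \<cdot>\<^sub>v (CWC *\<^sub>v x)"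
  using BQB_carrier CWC_carrier
  by (simp only: add_mult_distrib_mat_vec[of _ n n] smult_mat_mult_vec[of _ n n] smult_carrier_mat)

lemma E_form:
  assumes x: "x \<in> carrier_vec n" and y: "y \<in> carrier_vec n"
  shows "x \<bullet> (E *\<^sub>v y) = \<gamma> * (x \<bullet> (BQB *\<^sub>v y)) + \<delta> * (x \<bullet> (CWC *\<^sub>v y))"
proof -
  have "BQB *\<^sub>v y \<in> carrier_vec n" "CWC *\<^sub>v y \<in> carrier_vec n"
    using mult_mat_vec_carrier[OF BQB_carrier y] mult_mat_vec_carrier[OF CWC_carrier y] .
  then show ?thesis
    unfolding E_vec[OF y] using x by (subst scalar_prod_add_distrib[of _ n]) auto
qed

lemma G_form:
  assumes x: "x \<in> carrier_vec n" and y: "y \<in> carrier_vec n"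
  shows "x \<bullet> (G *\<^sub>v y) = x \<bullet> (A *\<^sub>v y) + x \<bullet> (E *\<^sub>v y)"
proof -
  have G: "G = A + E"
    unfolding aug_block_def using A_carrier BQB_carrier CWC_carrier
    by (intro assoc_add_mat[of _ n n]) auto
  have "A *\<^sub>v y \<in> carrier_vec n" "E *\<^sub>v y \<in> carrier_vec n"
    using mult_mat_vec_carrier[OF A_carrier y] mult_mat_vec_carrier[OF E_carrier y] .
  then show ?thesis
    unfolding G add_mult_distrib_mat_vec[OF A_carrier E_carrier y]
    using x by (subst scalar_prod_add_distrib[of _ n]) auto
qed

lemma E_transpose: "transpose_mat E = E"
proof (rule transpose_eq_if_bilinear_sym[OF E_carrier])
  fix x y :: "real vec" assume xy: "x \<in> carrier_vec n" "y \<in> carrier_vec n"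
  then have "B *\<^sub>v x \<in> carrier_vec m" "B *\<^sub>v y \<in> carrier_vec m"
    "C *\<^sub>v x \<in> carrier_vec l" "C *\<^sub>v y \<in> carrier_vec l"
    using B C by auto
  then show "x \<bullet> (E *\<^sub>v y) = y \<bullet> (E *\<^sub>v x)"
    using xy sym_bilinear[OF inv_Q_carrier sym_pos_def_transpose[OF inv_Q]]
      sym_bilinear[OF inv_W_carrier sym_pos_def_transpose[OF inv_W]]
    by (simp add: E_form BQB_form CWC_form)
qed

lemma E_nonneg: "x \<in> carrier_vec n \<Longrightarrow> 0 \<le> x \<bullet> (E *\<^sub>v x)"
  using BQB_nonneg CWC_nonneg \<gamma> \<delta> by (simp add: E_form)

text \<open>\<open>G\<close> is the sum of the positive definite \<open>A\<close> and the positive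
  semidefinite \<open>E\<close>.\<close>

lemma G_spd: "sym_pos_def n G"
  unfolding sym_pos_def_def
proof (intro conjI ballI impI)
  show "transpose_mat G = G"
    using sym_bilinear[OF A_carrier sym_pos_def_transpose[OF A]] sym_bilinear[OF E_carrier E_transpose]
    by (intro transpose_eq_if_bilinear_sym[OF G_carrier]) (simp add: G_form)
  show "0 < x \<bullet> (G *\<^sub>v x)" if "x \<in> carrier_vec n" "x \<noteq> 0\<^sub>v n" for x
    using that sym_pos_def_pos[OF A] E_nonneg by (simp add: G_form add_pos_nonneg)
qed (rule G_carrier)

text \<open>If \<open>E\<close> were zero, both non-negative summands of its form would vanish.
  Definiteness of the inverse of \<open>W\<close> would then give \<open>C x = 0\<close> for every
  \<open>x\<close>, against \<open>C \<noteq> 0\<close>.\<close>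

lemma E_nonzero: "E \<noteq> 0\<^sub>m n n"
proof
  assume E0: "E = 0\<^sub>m n n"
  have "C *\<^sub>v x = 0\<^sub>v l" if x: "x \<in> carrier_vec n" for x
  proof -
    have Cx: "C *\<^sub>v x \<in> carrier_vec l" using C x by simp
    have "x \<bullet> (E *\<^sub>v x) = 0" using x by (simp add: E0 zero_mult_vec)
    then have "x \<bullet> (CWC *\<^sub>v x) = 0"
      using BQB_nonneg[OF x] CWC_nonneg[OF x] \<gamma> \<delta> x
      by (simp add: E_form add_nonneg_eq_0_iff)
    then show ?thesis
      using sym_pos_def_eq_zero_iff[OF inv_W Cx] x by (simp add: CWC_form)
  qed
  then show False using eq_zero_mat_if_mult_vec_zero[OF C] C_nz by blast
qed

text \<open>The first block of both \<open>S (x; y; z)\<close> and \<open>P (x; y; z)\<close>; for an eigenvalue other than 1 it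
  must therefore vanish.\<close>

definition first_row where
  "first_row x y z = G *\<^sub>v x + (transpose_mat B *\<^sub>v y + transpose_mat C *\<^sub>v z)"

abbreviation "block_vec x y z \<equiv> x \<in> carrier_vec n \<and> y \<in> carrier_vec m \<and> z \<in> carrier_vec l"

lemma first_row_carrier: "block_vec x y z \<Longrightarrow> first_row x y z \<in> carrier_vec n"
  using G_carrier B C unfolding first_row_def by (auto intro!: add_carrier_vec)

lemma first_row_form:
  assumes v: "block_vec x y z" and x': "x' \<in> carrier_vec n"
  shows "x' \<bullet> first_row x y z = x' \<bullet> (G *\<^sub>v x) + (B *\<^sub>v x') \<bullet> y + (C *\<^sub>v x') \<bullet> z"
proof -
  have c: "G *\<^sub>v x \<in> carrier_vec n" "transpose_mat B *\<^sub>v y \<in> carrier_vec n"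
    "transpose_mat C *\<^sub>v z \<in> carrier_vec n"
    using G_carrier B C v by auto
  have "x' \<bullet> (transpose_mat B *\<^sub>v y) = (B *\<^sub>v x') \<bullet> y"
    using transpose_vec_mult_scalar[OF B x', of y] comm_scalar_prod[OF x' c(2)]
      comm_scalar_prod[of y m "B *\<^sub>v x'"] B x' v by simp
  moreover have "x' \<bullet> (transpose_mat C *\<^sub>v z) = (C *\<^sub>v x') \<bullet> z"
    using transpose_vec_mult_scalar[OF C x', of z] comm_scalar_prod[OF x' c(3)]
      comm_scalar_prod[of z l "C *\<^sub>v x'"] C x' v by simp
  ultimately show ?thesis
    unfolding first_row_def using c x' by (simp add: scalar_prod_add_distrib[of _ n])
qed

lemma S_carrier: "S \<in> carrier_mat (n + (m + l)) (n + (m + l))"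
  using G_carrier B C unfolding saddle_mat_def Let_def
  by (intro carrier_append_rows append_cols_carrier) auto

lemma P_carrier: "P \<in> carrier_mat (n + (m + l)) (n + (m + l))"
  using A_carrier G_carrier B C Q_carrier W_carrier unfolding precond_mat_def Let_def
  by (intro carrier_append_rows append_cols_carrier) auto

lemma S_mult_vec:
  assumes v: "block_vec x y z"
  shows "S *\<^sub>v (x @\<^sub>v y @\<^sub>v z) = first_row x y z @\<^sub>v B *\<^sub>v x @\<^sub>v C *\<^sub>v x"
proof -
  let ?v = "x @\<^sub>v y @\<^sub>v z"
  have vc: "?v \<in> carrier_vec (n + (m + l))" using v by auto
  have "S *\<^sub>v ?v
    = (G @\<^sub>c transpose_mat B @\<^sub>c transpose_mat C) *\<^sub>v ?v
      @\<^sub>v (B @\<^sub>c 0\<^sub>m m m @\<^sub>c 0\<^sub>m m l) *\<^sub>v ?v @\<^sub>v (C @\<^sub>c 0\<^sub>m l m @\<^sub>c 0\<^sub>m l l) *\<^sub>v ?v"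
    unfolding saddle_mat_def Let_def using G_carrier B C vc
    by (subst mat_mult_append[of _ n "n + (m + l)" _ "m + l"]
         mat_mult_append[of _ m "n + (m + l)" _ l]; auto intro!: append_cols_carrier carrier_append_rows)+
  moreover have "(G @\<^sub>c transpose_mat B @\<^sub>c transpose_mat C) *\<^sub>v ?v = first_row x y z"
    unfolding first_row_def using G_carrier B C v
    by (subst append_cols_mult_vec[of _ n n _ "m + l"] append_cols_mult_vec[of _ n m _ l];
        auto intro!: append_cols_carrier)+
  moreover have "(B @\<^sub>c 0\<^sub>m m m @\<^sub>c 0\<^sub>m m l) *\<^sub>v ?v = B *\<^sub>v x"
    using B v append_cols_mult_vec[of "0\<^sub>m m m" m m "0\<^sub>m m l" l y z]
    by (subst append_cols_mult_vec[of _ m n _ "m + l"]) (auto intro!: append_cols_carrier simp: zero_mult_vec)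
  moreover have "(C @\<^sub>c 0\<^sub>m l m @\<^sub>c 0\<^sub>m l l) *\<^sub>v ?v = C *\<^sub>v x"
    using C v append_cols_mult_vec[of "0\<^sub>m l m" l m "0\<^sub>m l l" l y z]
    by (subst append_cols_mult_vec[of _ l n _ "m + l"]) (auto intro!: append_cols_carrier simp: zero_mult_vec)
  ultimately show ?thesis by simp
qed

lemma P_mult_vec:
  assumes v: "block_vec x y z"
  shows "P *\<^sub>v (x @\<^sub>v y @\<^sub>v z)
    = first_row x y z @\<^sub>v (- (1 / \<gamma>)) \<cdot>\<^sub>v (Q *\<^sub>v y) @\<^sub>v (- (1 / \<delta>)) \<cdot>\<^sub>v (W *\<^sub>v z)"
proof -
  let ?v = "x @\<^sub>v y @\<^sub>v z"
  have vc: "?v \<in> carrier_vec (n + (m + l))" using v by auto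
  have dims: "dim_row A = n" "dim_row B = m" "dim_row C = l" using A_carrier B C by auto
  have "P *\<^sub>v ?v
    = (G @\<^sub>c transpose_mat B @\<^sub>c transpose_mat C) *\<^sub>v ?v
      @\<^sub>v (0\<^sub>m m n @\<^sub>c (- (1 / \<gamma>)) \<cdot>\<^sub>m Q @\<^sub>c 0\<^sub>m m l) *\<^sub>v ?v
      @\<^sub>v (0\<^sub>m l n @\<^sub>c 0\<^sub>m l m @\<^sub>c (- (1 / \<delta>)) \<cdot>\<^sub>m W) *\<^sub>v ?v"
    unfolding precond_mat_def Let_def dims using G_carrier B C Q_carrier W_carrier vc
    by (subst mat_mult_append[of _ n "n + (m + l)" _ "m + l"]
         mat_mult_append[of _ m "n + (m + l)" _ l]; auto intro!: append_cols_carrier carrier_append_rows)+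
  moreover have "(G @\<^sub>c transpose_mat B @\<^sub>c transpose_mat C) *\<^sub>v ?v = first_row x y z"
    unfolding first_row_def using G_carrier B C v
    by (subst append_cols_mult_vec[of _ n n _ "m + l"] append_cols_mult_vec[of _ n m _ l];
        auto intro!: append_cols_carrier)+
  moreover have "(0\<^sub>m m n @\<^sub>c (- (1 / \<gamma>)) \<cdot>\<^sub>m Q @\<^sub>c 0\<^sub>m m l) *\<^sub>v ?v = (- (1 / \<gamma>)) \<cdot>\<^sub>v (Q *\<^sub>v y)"
    using Q_carrier v append_cols_mult_vec[of "(- (1 / \<gamma>)) \<cdot>\<^sub>m Q" m m "0\<^sub>m m l" l y z]
    by (subst append_cols_mult_vec[of _ m n _ "m + l"])
      (auto intro!: append_cols_carrier simp: zero_mult_vec smult_mat_mult_vec[of _ m m])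
  moreover have "(0\<^sub>m l n @\<^sub>c 0\<^sub>m l m @\<^sub>c (- (1 / \<delta>)) \<cdot>\<^sub>m W) *\<^sub>v ?v = (- (1 / \<delta>)) \<cdot>\<^sub>v (W *\<^sub>v z)"
    using W_carrier v append_cols_mult_vec[of "0\<^sub>m l m" l m "(- (1 / \<delta>)) \<cdot>\<^sub>m W" l y z]
    by (subst append_cols_mult_vec[of _ l n _ "m + l"])
      (auto intro!: append_cols_carrier simp: zero_mult_vec smult_mat_mult_vec[of _ l l])
  ultimately show ?thesis by simp
qed

text \<open>\<open>P\<close> is block upper triangular with definite diagonal blocks, so a kernel
  vector vanishes block by block: first \<open>y\<close> and \<open>z\<close>, then
  \<open>x\<close>, for which the first row reduces to \<open>G x\<close>.\<close>

lemma P_invertible: "invertible_mat P"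
proof (rule invertible_mat_if_kernel_trivial[OF P_carrier])
  fix v assume "v \<in> carrier_vec (n + (m + l))" and Pv: "P *\<^sub>v v = 0\<^sub>v (n + (m + l))"
  then obtain x y z where v: "block_vec x y z" and v_eq: "v = x @\<^sub>v y @\<^sub>v z"
    using append_vec_cases3 by metis
  have eqs: "first_row x y z = 0\<^sub>v n" "(- (1 / \<gamma>)) \<cdot>\<^sub>v (Q *\<^sub>v y) = 0\<^sub>v m"
    "(- (1 / \<delta>)) \<cdot>\<^sub>v (W *\<^sub>v z) = 0\<^sub>v l"
    using Pv v first_row_carrier[OF v] Q_carrier W_carrier
    unfolding v_eq P_mult_vec[OF v] zero_append_vec3
    by (subst (asm) append_vec3_eq_iff[of _ n _ _ m]; auto)+
  have "y \<bullet> ((- (1 / \<gamma>)) \<cdot>\<^sub>v (Q *\<^sub>v y)) = 0" using eqs(2) v by simp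
  then have y: "y = 0\<^sub>v m" using sym_pos_def_eq_zero_iff[OF Q] v Q_carrier \<gamma> by simp
  have "z \<bullet> ((- (1 / \<delta>)) \<cdot>\<^sub>v (W *\<^sub>v z)) = 0" using eqs(3) v by simp
  then have z: "z = 0\<^sub>v l" using sym_pos_def_eq_zero_iff[OF W] v W_carrier \<delta> by simp
  have "x \<bullet> (G *\<^sub>v x) = x \<bullet> first_row x y z"
    using first_row_form[OF v, of x] v B C unfolding y z by simp
  then have "x = 0\<^sub>v n" using eqs(1) sym_pos_def_eq_zero_iff[OF G_spd] v by simp
  then show "v = 0\<^sub>v (n + (m + l))" unfolding v_eq y z zero_append_vec3 by simp
qed

lemmas P_inv = mat_inv[OF P_carrier P_invertible]

lemma T_carrier: "T \<in> carrier_mat (n + (m + l)) (n + (m + l))"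
  using P_inv S_carrier unfolding precond_saddle_mat_def by simp

text \<open>Clearing the inverse turns statements about \<open>T\<close> into block equations
  between \<open>S\<close> and \<open>P\<close>; the blocks of the inverse of \<open>P\<close> never
  have to be computed.\<close>

lemma T_mult_vec_eq_iff:
  assumes v: "v \<in> carrier_vec (n + (m + l))" and w: "w \<in> carrier_vec (n + (m + l))"
  shows "T *\<^sub>v v = w \<longleftrightarrow> S *\<^sub>v v = P *\<^sub>v w"
proof -
  let ?k = "n + (m + l)"
  have Sv: "S *\<^sub>v v \<in> carrier_vec ?k"
    using S_carrier v by auto
  have "T *\<^sub>v v = mat_inv P *\<^sub>v (S *\<^sub>v v)"
    unfolding precond_saddle_mat_def using P_inv(1) S_carrier v by (rule assoc_mult_mat_vec)
  moreover have "P *\<^sub>v (mat_inv P *\<^sub>v (S *\<^sub>v v)) = S *\<^sub>v v"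
    using assoc_mult_mat_vec[OF P_carrier P_inv(1) Sv] P_inv(2) Sv by simp
  moreover have "mat_inv P *\<^sub>v (P *\<^sub>v w) = w"
    using assoc_mult_mat_vec[OF P_inv(1) P_carrier w] P_inv(3) w by simp
  ultimately show ?thesis by metis
qed

section \<open>Eigenvectors of the preconditioned matrix\<close>

text \<open>Two vectors occur on the right because the real and imaginary parts of a complex
  eigenvector are mixed by \<open>T\<close>. A real eigenvector is the case
  \<open>b = 0\<close>.\<close>

lemma T_mult_vec_combination:
  assumes v: "block_vec x y z" "block_vec x1 y1 z1" "block_vec x2 y2 z2"
    and eq: "T *\<^sub>v (x @\<^sub>v y @\<^sub>v z) = a \<cdot>\<^sub>v (x1 @\<^sub>v y1 @\<^sub>v z1) + b \<cdot>\<^sub>v (x2 @\<^sub>v y2 @\<^sub>v z2)"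
  shows "first_row x y z = a \<cdot>\<^sub>v first_row x1 y1 z1 + b \<cdot>\<^sub>v first_row x2 y2 z2"
    "B *\<^sub>v x = (- (a / \<gamma>)) \<cdot>\<^sub>v (Q *\<^sub>v y1) + (- (b / \<gamma>)) \<cdot>\<^sub>v (Q *\<^sub>v y2)"
    "C *\<^sub>v x = (- (a / \<delta>)) \<cdot>\<^sub>v (W *\<^sub>v z1) + (- (b / \<delta>)) \<cdot>\<^sub>v (W *\<^sub>v z2)"
proof -
  let ?v = "x @\<^sub>v y @\<^sub>v z" and ?v1 = "x1 @\<^sub>v y1 @\<^sub>v z1" and ?v2 = "x2 @\<^sub>v y2 @\<^sub>v z2"
  have c: "?v \<in> carrier_vec (n + (m + l))" "?v1 \<in> carrier_vec (n + (m + l))"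
    "?v2 \<in> carrier_vec (n + (m + l))"
    using v by auto
  have "S *\<^sub>v ?v = P *\<^sub>v (a \<cdot>\<^sub>v ?v1 + b \<cdot>\<^sub>v ?v2)"
    using T_mult_vec_eq_iff[OF c(1), of "a \<cdot>\<^sub>v ?v1 + b \<cdot>\<^sub>v ?v2"] eq c by simp
  also have "\<dots> = a \<cdot>\<^sub>v (P *\<^sub>v ?v1) + b \<cdot>\<^sub>v (P *\<^sub>v ?v2)"
    using c by (simp add: mult_add_distrib_mat_vec[OF P_carrier] mult_mat_vec[OF P_carrier])
  also have "\<dots> = (a \<cdot>\<^sub>v first_row x1 y1 z1 + b \<cdot>\<^sub>v first_row x2 y2 z2)
      @\<^sub>v (a \<cdot>\<^sub>v ((- (1 / \<gamma>)) \<cdot>\<^sub>v (Q *\<^sub>v y1)) + b \<cdot>\<^sub>v ((- (1 / \<gamma>)) \<cdot>\<^sub>v (Q *\<^sub>v y2)))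
      @\<^sub>v (a \<cdot>\<^sub>v ((- (1 / \<delta>)) \<cdot>\<^sub>v (W *\<^sub>v z1)) + b \<cdot>\<^sub>v ((- (1 / \<delta>)) \<cdot>\<^sub>v (W *\<^sub>v z2)))"
    unfolding P_mult_vec[OF v(2)] P_mult_vec[OF v(3)] smult_append_vec
    using first_row_carrier[OF v(2)] first_row_carrier[OF v(3)] Q_carrier W_carrier v
    by (subst append_vec_add[of _ n _ _ "m + l"] append_vec_add[of _ m _ _ l]; auto)+
  finally have "first_row x y z @\<^sub>v B *\<^sub>v x @\<^sub>v C *\<^sub>v x = \<dots>"
    unfolding S_mult_vec[OF v(1)] .
  then have *: "first_row x y z = a \<cdot>\<^sub>v first_row x1 y1 z1 + b \<cdot>\<^sub>v first_row x2 y2 z2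
    \<and> B *\<^sub>v x = a \<cdot>\<^sub>v ((- (1 / \<gamma>)) \<cdot>\<^sub>v (Q *\<^sub>v y1)) + b \<cdot>\<^sub>v ((- (1 / \<gamma>)) \<cdot>\<^sub>v (Q *\<^sub>v y2))
    \<and> C *\<^sub>v x = a \<cdot>\<^sub>v ((- (1 / \<delta>)) \<cdot>\<^sub>v (W *\<^sub>v z1)) + b \<cdot>\<^sub>v ((- (1 / \<delta>)) \<cdot>\<^sub>v (W *\<^sub>v z2))"
    using first_row_carrier[OF v(1)] first_row_carrier[OF v(2)] first_row_carrier[OF v(3)]
      B C Q_carrier W_carrier v
    by (subst (asm) append_vec3_eq_iff[of _ n _ _ m]) auto
  then show "first_row x y z = a \<cdot>\<^sub>v first_row x1 y1 z1 + b \<cdot>\<^sub>v first_row x2 y2 z2"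
    "B *\<^sub>v x = (- (a / \<gamma>)) \<cdot>\<^sub>v (Q *\<^sub>v y1) + (- (b / \<gamma>)) \<cdot>\<^sub>v (Q *\<^sub>v y2)"
    "C *\<^sub>v x = (- (a / \<delta>)) \<cdot>\<^sub>v (W *\<^sub>v z1) + (- (b / \<delta>)) \<cdot>\<^sub>v (W *\<^sub>v z2)"
    by (simp_all add: smult_smult_assoc)
qed

lemma eigenvector_blocks:
  assumes ev: "eigenvector T (x @\<^sub>v y @\<^sub>v z) r" and v: "block_vec x y z"
  shows "first_row x y z = r \<cdot>\<^sub>v first_row x y z"
    "B *\<^sub>v x = (- (r / \<gamma>)) \<cdot>\<^sub>v (Q *\<^sub>v y)" "C *\<^sub>v x = (- (r / \<delta>)) \<cdot>\<^sub>v (W *\<^sub>v z)"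
proof -
  have "T *\<^sub>v (x @\<^sub>v y @\<^sub>v z) = r \<cdot>\<^sub>v (x @\<^sub>v y @\<^sub>v z) + 0 \<cdot>\<^sub>v (x @\<^sub>v y @\<^sub>v z)"
    using ev unfolding eigenvector_def by (intro eq_vecI) auto
  note * = T_mult_vec_combination[OF v v v this]
  show "first_row x y z = r \<cdot>\<^sub>v first_row x y z"
    using *(1) first_row_carrier[OF v] by (metis add_smult_distrib_vec add_0_right)
  show "B *\<^sub>v x = (- (r / \<gamma>)) \<cdot>\<^sub>v (Q *\<^sub>v y)" "C *\<^sub>v x = (- (r / \<delta>)) \<cdot>\<^sub>v (W *\<^sub>v z)"
    using *(2,3) v Q_carrier W_carrier by (auto intro!: eq_vecI)
qed

lemma eigenvectorI:
  assumes v: "block_vec x y z" and x: "x \<noteq> 0\<^sub>v n"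
    and row: "first_row x y z = r \<cdot>\<^sub>v first_row x y z"
    and Bx: "B *\<^sub>v x = (- (r / \<gamma>)) \<cdot>\<^sub>v (Q *\<^sub>v y)" and Cx: "C *\<^sub>v x = (- (r / \<delta>)) \<cdot>\<^sub>v (W *\<^sub>v z)"
  shows "eigenvector T (x @\<^sub>v y @\<^sub>v z) r"
proof -
  let ?v = "x @\<^sub>v y @\<^sub>v z"
  have c: "?v \<in> carrier_vec (n + (m + l))" using v by auto
  have "S *\<^sub>v ?v = r \<cdot>\<^sub>v (P *\<^sub>v ?v)"
    unfolding S_mult_vec[OF v] P_mult_vec[OF v] smult_append_vec row[symmetric] Bx Cx
    by (simp add: smult_smult_assoc)
  then have "T *\<^sub>v ?v = r \<cdot>\<^sub>v ?v"
    using T_mult_vec_eq_iff[OF c, of "r \<cdot>\<^sub>v ?v"] c mult_mat_vec[OF P_carrier c] by simp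
  moreover have "?v \<noteq> 0\<^sub>v (n + (m + l))"
    unfolding zero_append_vec3 using append_vec3_eq_iff[of x n "0\<^sub>v n" y m "0\<^sub>v m"] v x by auto
  ultimately show ?thesis unfolding eigenvector_def using T_carrier c by simp
qed

text \<open>For \<open>\<mu> \<noteq> 1\<close> the first row gives \<open>x\<^sup>*Gx = \<mu>' (y\<^sup>*Qy / \<gamma> + z\<^sup>*Wz / \<delta>)\<close> with \<open>\<mu>'\<close> the conjugate of
  \<open>\<mu>\<close>. The proof computes the real and imaginary parts of this identity for the complex eigenvector
  \<open>p + i q\<close>; \<open>g\<close> and \<open>s\<close> are its two quadratic expressions.\<close>

lemma spectrum_real_nonneg:
  assumes ev: "eigenvalue (map_mat complex_of_real T) \<mu>"
  shows "Im \<mu> = 0 \<and> 0 \<le> Re \<mu>"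
proof (cases "\<mu> = 1")
  case False
  obtain p q where pq: "p \<in> carrier_vec (n + (m + l))" "q \<in> carrier_vec (n + (m + l))"
      "p \<noteq> 0\<^sub>v (n + (m + l)) \<or> q \<noteq> 0\<^sub>v (n + (m + l))"
    and Tp: "T *\<^sub>v p = Re \<mu> \<cdot>\<^sub>v p + (- Im \<mu>) \<cdot>\<^sub>v q"
    and Tq: "T *\<^sub>v q = Im \<mu> \<cdot>\<^sub>v p + Re \<mu> \<cdot>\<^sub>v q"
    using complex_eigenvalue_real_parts[OF T_carrier ev] by metis
  obtain x1 y1 z1 where v1: "block_vec x1 y1 z1" and p: "p = x1 @\<^sub>v y1 @\<^sub>v z1"
    using append_vec_cases3[OF pq(1)] by metis
  obtain x2 y2 z2 where v2: "block_vec x2 y2 z2" and q: "q = x2 @\<^sub>v y2 @\<^sub>v z2"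
    using append_vec_cases3[OF pq(2)] by metis
  define \<alpha> \<beta> where "\<alpha> = Re \<mu>" and "\<beta> = Im \<mu>"
  note eq1 = T_mult_vec_combination[OF v1 v1 v2 Tp[unfolded p q], folded \<alpha>_def \<beta>_def]
  note eq2 = T_mult_vec_combination[OF v2 v1 v2 Tq[unfolded p q], folded \<alpha>_def \<beta>_def]
  define u1 u2 where "u1 = first_row x1 y1 z1" and "u2 = first_row x2 y2 z2"
  have u: "u1 \<in> carrier_vec n" "u2 \<in> carrier_vec n"
    using first_row_carrier v1 v2 unfolding u1_def u2_def by auto
  have u_eq: "u1 = \<alpha> \<cdot>\<^sub>v u1 + (- \<beta>) \<cdot>\<^sub>v u2" "u2 = \<beta> \<cdot>\<^sub>v u1 + \<alpha> \<cdot>\<^sub>v u2"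
    using eq1(1) eq2(1) unfolding u1_def u2_def .
  have "\<alpha> \<noteq> 1 \<or> \<beta> \<noteq> 0" using False by (auto simp: \<alpha>_def \<beta>_def complex_eq_iff)
  then have norm: "(\<alpha> - 1)\<^sup>2 + \<beta>\<^sup>2 \<noteq> 0" by (simp add: sum_power2_eq_zero_iff)
  \<comment> \<open>This is \<open>(\<mu> - 1) (a + i b) = 0\<close> in real coordinates, solved by
    multiplying with the conjugate of \<open>\<mu> - 1\<close>; \<open>norm\<close> says that the
    squared modulus of \<open>\<mu> - 1\<close> is not zero.\<close>
  have zero: "a = 0 \<and> b = 0" if a: "a = \<alpha> * a + (- \<beta>) * b" and b: "b = \<beta> * a + \<alpha> * b" for a b :: real
  proof -
    have "(\<alpha> - 1) * a - \<beta> * b = 0" "\<beta> * a + (\<alpha> - 1) * b = 0"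
      using a b by argo+
    moreover have "((\<alpha> - 1)\<^sup>2 + \<beta>\<^sup>2) * a
        = (\<alpha> - 1) * ((\<alpha> - 1) * a - \<beta> * b) + \<beta> * (\<beta> * a + (\<alpha> - 1) * b)"
      "((\<alpha> - 1)\<^sup>2 + \<beta>\<^sup>2) * b
        = (\<alpha> - 1) * (\<beta> * a + (\<alpha> - 1) * b) - \<beta> * ((\<alpha> - 1) * a - \<beta> * b)"
      by (simp_all add: power2_eq_square algebra_simps)
    ultimately have "((\<alpha> - 1)\<^sup>2 + \<beta>\<^sup>2) * a = 0" "((\<alpha> - 1)\<^sup>2 + \<beta>\<^sup>2) * b = 0"
      by (simp_all only: mult_zero_right add_0 diff_0_right)
    then show ?thesis using norm by (metis mult_eq_0_iff)
  qed
  have "u1 $ i = 0 \<and> u2 $ i = 0" if i: "i < n" for i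
  proof (rule zero)
    show "u1 $ i = \<alpha> * u1 $ i + (- \<beta>) * u2 $ i" using u i by (subst u_eq(1)) simp
    show "u2 $ i = \<beta> * u1 $ i + \<alpha> * u2 $ i" using u i by (subst u_eq(2)) simp
  qed
  then have u0: "u1 = 0\<^sub>v n" "u2 = 0\<^sub>v n" using u by (auto intro!: eq_vecI)
  define g where "g = x1 \<bullet> (G *\<^sub>v x1) + x2 \<bullet> (G *\<^sub>v x2)"
  define s where "s = (y1 \<bullet> (Q *\<^sub>v y1) + y2 \<bullet> (Q *\<^sub>v y2)) / \<gamma> + (z1 \<bullet> (W *\<^sub>v z1) + z2 \<bullet> (W *\<^sub>v z2)) / \<delta>"
  have carr: "G *\<^sub>v x1 \<in> carrier_vec n" "G *\<^sub>v x2 \<in> carrier_vec n"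
    "Q *\<^sub>v y1 \<in> carrier_vec m" "Q *\<^sub>v y2 \<in> carrier_vec m"
    "W *\<^sub>v z1 \<in> carrier_vec l" "W *\<^sub>v z2 \<in> carrier_vec l"
    using G_carrier Q_carrier W_carrier v1 v2 by auto
  have Qsym: "(Q *\<^sub>v y) \<bullet> y' = y \<bullet> (Q *\<^sub>v y')" if "y \<in> carrier_vec m" "y' \<in> carrier_vec m" for y y'
    using transpose_vec_mult_scalar[OF Q_carrier, of y' y] that sym_pos_def_transpose[OF Q] by simp
  have Wsym: "(W *\<^sub>v z) \<bullet> z' = z \<bullet> (W *\<^sub>v z')" if "z \<in> carrier_vec l" "z' \<in> carrier_vec l" for z z'
    using transpose_vec_mult_scalar[OF W_carrier, of z' z] that sym_pos_def_transpose[OF W] by simp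
  have sym: "x1 \<bullet> (G *\<^sub>v x2) = x2 \<bullet> (G *\<^sub>v x1)" "y1 \<bullet> (Q *\<^sub>v y2) = y2 \<bullet> (Q *\<^sub>v y1)"
    "z1 \<bullet> (W *\<^sub>v z2) = z2 \<bullet> (W *\<^sub>v z1)"
    using sym_bilinear[OF G_carrier sym_pos_def_transpose[OF G_spd]]
      sym_bilinear[OF Q_carrier sym_pos_def_transpose[OF Q]]
      sym_bilinear[OF W_carrier sym_pos_def_transpose[OF W]] v1 v2 by auto
  note forms = first_row_form[OF v1, folded u1_def, unfolded u0] first_row_form[OF v2, folded u2_def, unfolded u0]
  note expand = add_scalar_prod_distrib[of _ m] add_scalar_prod_distrib[of _ l] Qsym Wsym
  \<comment> \<open>Each fact pairs the first block named by its first digit with the first row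
    named by its second (\<open>f12\<close> pairs \<open>x1\<close> with \<open>u2\<close>). The
    rows are zero, and the lower block equations replace \<open>B\<close> and \<open>C\<close>
    applied to the first blocks.\<close>
  have f11: "0 = x1 \<bullet> (G *\<^sub>v x1) - (\<alpha> * (y1 \<bullet> (Q *\<^sub>v y1)) - \<beta> * (y2 \<bullet> (Q *\<^sub>v y1))) / \<gamma>
      - (\<alpha> * (z1 \<bullet> (W *\<^sub>v z1)) - \<beta> * (z2 \<bullet> (W *\<^sub>v z1))) / \<delta>"
    using forms(1)[of x1] v1 v2 carr unfolding eq1(2,3)
    by (simp add: expand diff_divide_distrib)
  have f22: "0 = x2 \<bullet> (G *\<^sub>v x2) - (\<beta> * (y1 \<bullet> (Q *\<^sub>v y2)) + \<alpha> * (y2 \<bullet> (Q *\<^sub>v y2))) / \<gamma>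
      - (\<beta> * (z1 \<bullet> (W *\<^sub>v z2)) + \<alpha> * (z2 \<bullet> (W *\<^sub>v z2))) / \<delta>"
    using forms(2)[of x2] v1 v2 carr unfolding eq2(2,3)
    by (simp add: expand diff_divide_distrib add_divide_distrib)
  have f12: "0 = x1 \<bullet> (G *\<^sub>v x2) - (\<alpha> * (y1 \<bullet> (Q *\<^sub>v y2)) - \<beta> * (y2 \<bullet> (Q *\<^sub>v y2))) / \<gamma>
      - (\<alpha> * (z1 \<bullet> (W *\<^sub>v z2)) - \<beta> * (z2 \<bullet> (W *\<^sub>v z2))) / \<delta>"
    using forms(2)[of x1] v1 v2 carr unfolding eq1(2,3)
    by (simp add: expand diff_divide_distrib)
  have f21: "0 = x2 \<bullet> (G *\<^sub>v x1) - (\<beta> * (y1 \<bullet> (Q *\<^sub>v y1)) + \<alpha> * (y2 \<bullet> (Q *\<^sub>v y1))) / \<gamma>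
      - (\<beta> * (z1 \<bullet> (W *\<^sub>v z1)) + \<alpha> * (z2 \<bullet> (W *\<^sub>v z1))) / \<delta>"
    using forms(1)[of x2] v1 v2 carr unfolding eq2(2,3)
    by (simp add: expand diff_divide_distrib add_divide_distrib)
  \<comment> \<open>In \<open>f11 + f22\<close> the \<open>\<beta>\<close> terms cancel by symmetry.
    In \<open>f12 - f21\<close>, used next, the \<open>\<alpha>\<close> terms cancel and
    \<open>\<beta> * s\<close> is left.\<close>
  have g: "g = \<alpha> * s"
    using f11 f22 sym unfolding g_def s_def
    by (simp add: diff_divide_distrib add_divide_distrib algebra_simps)
  have \<beta>s: "\<beta> * s = 0"
    using f12 f21 sym unfolding s_def
    by (simp add: diff_divide_distrib add_divide_distrib algebra_simps)
  have nonneg: "0 \<le> x1 \<bullet> (G *\<^sub>v x1)" "0 \<le> x2 \<bullet> (G *\<^sub>v x2)"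
    "0 \<le> y1 \<bullet> (Q *\<^sub>v y1)" "0 \<le> y2 \<bullet> (Q *\<^sub>v y2)" "0 \<le> z1 \<bullet> (W *\<^sub>v z1)" "0 \<le> z2 \<bullet> (W *\<^sub>v z2)"
    using sym_pos_def_nonneg[OF G_spd] sym_pos_def_nonneg[OF Q] sym_pos_def_nonneg[OF W] v1 v2 by auto
  have s_nonneg: "0 \<le> s" and g_nonneg: "0 \<le> g" using nonneg \<gamma> \<delta> unfolding s_def g_def by simp_all
  \<comment> \<open>If \<open>s = 0\<close>, then also \<open>g = \<alpha> * s = 0\<close>, and
    definiteness makes all six blocks vanish. Hence \<open>\<beta> = 0\<close>, and
    \<open>\<alpha>\<close> is non-negative because \<open>g\<close> is.\<close>
  have "s \<noteq> 0"
  proof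
    assume s0: "s = 0"
    then have "y1 \<bullet> (Q *\<^sub>v y1) + y2 \<bullet> (Q *\<^sub>v y2) = 0" "z1 \<bullet> (W *\<^sub>v z1) + z2 \<bullet> (W *\<^sub>v z2) = 0"
      using nonneg \<gamma> \<delta> unfolding s_def by (simp_all add: add_nonneg_eq_0_iff)
    moreover have "x1 \<bullet> (G *\<^sub>v x1) + x2 \<bullet> (G *\<^sub>v x2) = 0" using g s0 unfolding g_def by simp
    ultimately have "x1 = 0\<^sub>v n" "x2 = 0\<^sub>v n" "y1 = 0\<^sub>v m" "y2 = 0\<^sub>v m" "z1 = 0\<^sub>v l" "z2 = 0\<^sub>v l"
      using nonneg v1 v2 sym_pos_def_eq_zero_iff[OF G_spd] sym_pos_def_eq_zero_iff[OF Q]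
        sym_pos_def_eq_zero_iff[OF W]
      by (simp_all add: add_nonneg_eq_0_iff)
    with pq(3) show False unfolding p q zero_append_vec3 by simp
  qed
  with s_nonneg \<beta>s g g_nonneg show ?thesis
    unfolding \<alpha>_def \<beta>_def by (simp add: zero_le_mult_iff)
qed simp

lemma eigenvector_rayleigh:
  assumes ev: "eigenvector T (x @\<^sub>v y @\<^sub>v z) r" and v: "block_vec x y z" and r: "r \<noteq> 1"
  shows "r * (x \<bullet> (G *\<^sub>v x)) = x \<bullet> (E *\<^sub>v x)"
proof -
  note eqs = eigenvector_blocks[OF ev v]
  have c: "B *\<^sub>v x \<in> carrier_vec m" "C *\<^sub>v x \<in> carrier_vec l" using B C v by auto
  have u: "first_row x y z = 0\<^sub>v n"
  proof (rule eq_vecI)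
    fix i assume "i < dim_vec (0\<^sub>v n :: real vec)"
    then have "first_row x y z $ i = r * first_row x y z $ i"
      using first_row_carrier[OF v] by (subst eqs(1)) simp
    then show "first_row x y z $ i = 0\<^sub>v n $ i" using r \<open>i < dim_vec (0\<^sub>v n)\<close> by simp
  qed (use first_row_carrier[OF v] in simp)
  have "mat_inv Q *\<^sub>v (B *\<^sub>v x) = (- (r / \<gamma>)) \<cdot>\<^sub>v y"
    unfolding eqs(2) using v Q_carrier sym_pos_def_mult_mat_inv_vec(2)[OF Q, of y]
    by (simp add: mult_mat_vec[OF inv_Q_carrier])
  then have 1: "\<gamma> * (x \<bullet> (BQB *\<^sub>v x)) = - r * ((B *\<^sub>v x) \<bullet> y)"
    using v c \<gamma> by (simp add: BQB_form)
  have "mat_inv W *\<^sub>v (C *\<^sub>v x) = (- (r / \<delta>)) \<cdot>\<^sub>v z"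
    unfolding eqs(3) using v W_carrier sym_pos_def_mult_mat_inv_vec(2)[OF W, of z]
    by (simp add: mult_mat_vec[OF inv_W_carrier])
  then have 2: "\<delta> * (x \<bullet> (CWC *\<^sub>v x)) = - r * ((C *\<^sub>v x) \<bullet> z)"
    using v c \<delta> by (simp add: CWC_form)
  have "x \<bullet> (G *\<^sub>v x) + (B *\<^sub>v x) \<bullet> y + (C *\<^sub>v x) \<bullet> z = 0"
    using first_row_form[OF v, of x] v unfolding u by simp
  then have "x \<bullet> (G *\<^sub>v x) = - ((B *\<^sub>v x) \<bullet> y) - (C *\<^sub>v x) \<bullet> z" by simp
  then have "r * (x \<bullet> (G *\<^sub>v x)) = - r * ((B *\<^sub>v x) \<bullet> y) + - r * ((C *\<^sub>v x) \<bullet> z)"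
    by (simp only:) (simp add: algebra_simps)
  then show ?thesis using 1 2 v by (simp add: E_form)
qed

text \<open>With \<open>x = 0\<close> and \<open>r \<noteq> 0\<close> the lower rows force
  \<open>Q y = 0\<close> and \<open>W z = 0\<close>, so the whole eigenvector would be zero.\<close>

lemma eigenvector_first_block_nonzero:
  assumes ev: "eigenvector T (x @\<^sub>v y @\<^sub>v z) r" and v: "block_vec x y z" and r: "r \<noteq> 0"
  shows "x \<noteq> 0\<^sub>v n"
proof
  assume x: "x = 0\<^sub>v n"
  note eqs = eigenvector_blocks[OF ev v, unfolded x]
  have "y \<bullet> ((- (r / \<gamma>)) \<cdot>\<^sub>v (Q *\<^sub>v y)) = 0"
    unfolding eqs(2)[symmetric] using B v by (simp add: mult_mat_zero_vec)
  then have y: "y = 0\<^sub>v m" using sym_pos_def_eq_zero_iff[OF Q] v Q_carrier \<gamma> r by simp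
  have "z \<bullet> ((- (r / \<delta>)) \<cdot>\<^sub>v (W *\<^sub>v z)) = 0"
    unfolding eqs(3)[symmetric] using C v by (simp add: mult_mat_zero_vec)
  then have z: "z = 0\<^sub>v l" using sym_pos_def_eq_zero_iff[OF W] v W_carrier \<delta> r by simp
  show False
    using ev T_carrier unfolding eigenvector_def x y z by (simp add: zero_append_vec3)
qed

lemma exists_eigenvector_not_0_1:
  obtains x y z r where "block_vec x y z" "eigenvector T (x @\<^sub>v y @\<^sub>v z) r" "r \<noteq> 0" "r \<noteq> 1"
proof -
  obtain r x where r: "r \<noteq> 0" and x: "x \<in> carrier_vec n" "x \<noteq> 0\<^sub>v n"
    and eq: "E *\<^sub>v x = r \<cdot>\<^sub>v (G *\<^sub>v x)"
    using pencil_nonzero_eigenvalue[OF G_spd E_carrier E_transpose E_nonzero] by metis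
  \<comment> \<open>For given \<open>x\<close> and \<open>r\<close>, these are the solutions
    \<open>y\<close> and \<open>z\<close> of the two lower block rows of the eigenvector
    equation.\<close>
  define y where "y = (- (\<gamma> / r)) \<cdot>\<^sub>v (mat_inv Q *\<^sub>v (B *\<^sub>v x))"
  define z where "z = (- (\<delta> / r)) \<cdot>\<^sub>v (mat_inv W *\<^sub>v (C *\<^sub>v x))"
  have c: "B *\<^sub>v x \<in> carrier_vec m" "C *\<^sub>v x \<in> carrier_vec l"
    "mat_inv Q *\<^sub>v (B *\<^sub>v x) \<in> carrier_vec m" "mat_inv W *\<^sub>v (C *\<^sub>v x) \<in> carrier_vec l"
    "G *\<^sub>v x \<in> carrier_vec n" "BQB *\<^sub>v x \<in> carrier_vec n" "CWC *\<^sub>v x \<in> carrier_vec n"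
    using B C inv_Q_carrier inv_W_carrier x G_carrier
      mult_mat_vec_carrier[OF BQB_carrier x(1)] mult_mat_vec_carrier[OF CWC_carrier x(1)] by auto
  have v: "block_vec x y z" using x c unfolding y_def z_def by simp
  have "transpose_mat B *\<^sub>v y = (- (\<gamma> / r)) \<cdot>\<^sub>v (BQB *\<^sub>v x)"
    unfolding y_def using B inv_Q_carrier x c
    by (simp add: mult_mat_vec[of _ n m] assoc_mult_mat_vec[of _ n m _ n] assoc_mult_mat_vec[of _ n m _ m])
  moreover have "transpose_mat C *\<^sub>v z = (- (\<delta> / r)) \<cdot>\<^sub>v (CWC *\<^sub>v x)"
    unfolding z_def using C inv_W_carrier x c
    by (simp add: mult_mat_vec[of _ n l] assoc_mult_mat_vec[of _ n l _ n] assoc_mult_mat_vec[of _ n l _ l])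
  \<comment> \<open>Here \<open>g\<close>, \<open>b\<close>, \<open>c\<close> stand for
    \<open>G x\<close>, \<open>BQB x\<close>, \<open>CWC x\<close>: the pencil equation divided by
    \<open>r\<close> makes the first row vanish.\<close>
  moreover have "g + ((- (\<gamma> / r)) \<cdot>\<^sub>v b + (- (\<delta> / r)) \<cdot>\<^sub>v c) = 0\<^sub>v n"
    if bcg: "b \<in> carrier_vec n" "c \<in> carrier_vec n" "g \<in> carrier_vec n"
      and eq: "\<gamma> \<cdot>\<^sub>v b + \<delta> \<cdot>\<^sub>v c = r \<cdot>\<^sub>v g" for b c g
  proof (rule eq_vecI)
    fix i assume "i < dim_vec (0\<^sub>v n :: real vec)"
    then have i: "i < n" by simp
    have "\<gamma> * b $ i + \<delta> * c $ i = r * g $ i"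
      using arg_cong[OF eq, of "\<lambda>w. w $ i"] i bcg by simp
    then show "(g + ((- (\<gamma> / r)) \<cdot>\<^sub>v b + (- (\<delta> / r)) \<cdot>\<^sub>v c)) $ i = 0\<^sub>v n $ i"
      using i bcg r by (simp add: field_simps)
  qed (use bcg in simp)
  note this[OF c(6,7,5) eq[unfolded E_vec[OF x(1)]]]
  ultimately have u: "first_row x y z = 0\<^sub>v n" unfolding first_row_def by simp
  have "B *\<^sub>v x = (- (r / \<gamma>)) \<cdot>\<^sub>v (Q *\<^sub>v y)" "C *\<^sub>v x = (- (r / \<delta>)) \<cdot>\<^sub>v (W *\<^sub>v z)"
    unfolding y_def z_def using c r \<gamma> \<delta> sym_pos_def_mult_mat_inv_vec(1)[OF Q c(1)]
      sym_pos_def_mult_mat_inv_vec(1)[OF W c(2)]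
    by (simp_all add: mult_mat_vec[OF Q_carrier] mult_mat_vec[OF W_carrier] smult_smult_assoc)
  with u have ev: "eigenvector T (x @\<^sub>v y @\<^sub>v z) r"
    using v x by (intro eigenvectorI) auto
  \<comment> \<open>The forms of \<open>G\<close> and \<open>E\<close> at \<open>x\<close> differ by
    that of \<open>A\<close>, which is positive, so \<open>r = 1\<close> is impossible.\<close>
  have "x \<bullet> (E *\<^sub>v x) = r * (x \<bullet> (G *\<^sub>v x))" unfolding eq using x c by simp
  then have "r \<noteq> 1"
    using sym_pos_def_pos[OF A x] G_form[OF x(1) x(1)] by auto
  with that v ev r show thesis by blast
qed

text \<open>\<open>T = P\<^sup>-\<^sup>1S\<close> is similar to \<open>SP\<^sup>-\<^sup>1\<close>, whose first \<open>n\<close> rows are those of \<open>PP\<^sup>-\<^sup>1\<close>.\<close>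

lemma order_one_char_poly: "n \<le> Polynomial.order 1 (char_poly T)"
proof -
  let ?k = "n + (m + l)"
  have "similar_mat T (S * mat_inv P)"
    unfolding similar_mat_def
  proof (intro exI, rule similar_mat_witI)
    show "mat_inv P * P = 1\<^sub>m ?k" "P * mat_inv P = 1\<^sub>m ?k" using P_inv by auto
    have "mat_inv P * (S * mat_inv P) * P = mat_inv P * (S * (mat_inv P * P))"
      using P_inv(1) P_carrier S_carrier by (simp add: assoc_mult_mat[of _ ?k ?k _ ?k _ ?k] del: assoc_mult_mat)
    then show "T = mat_inv P * (S * mat_inv P) * P"
      using P_inv(3) S_carrier unfolding precond_saddle_mat_def by simp
  qed (use T_carrier P_inv P_carrier S_carrier in auto)
  then have "char_poly T = char_poly (S * mat_inv P)" by (rule char_poly_similar)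
  moreover have "[:-1, 1:] ^ n dvd char_poly (S * mat_inv P)"
  proof (rule linear_power_dvd_char_poly)
    show "S * mat_inv P \<in> carrier_mat ?k ?k" using S_carrier P_inv by simp
    fix i j assume ij: "i < n" "j < ?k"
    have "row S i = row P i"
      using ij A_carrier G_carrier B C unfolding saddle_mat_def precond_mat_def
      by (intro eq_vecI) (auto simp: append_rows_def append_cols_def Let_def)
    then have "(S * mat_inv P) $$ (i, j) = (P * mat_inv P) $$ (i, j)"
      using ij S_carrier P_carrier P_inv(1) by simp
    then show "(S * mat_inv P) $$ (i, j) = (if i = j then 1 else 0)"
      using P_inv(2) ij by simp
  qed
  moreover have "char_poly T \<noteq> 0" using degree_monic_char_poly[OF T_carrier] by auto
  ultimately show ?thesis using order_divides[of 1 n "char_poly T"] by auto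
qed

text \<open>Once \<open>Im \<mu> = 0\<close>, the two parts of the complex eigenvector satisfy the
  real eigenvector equation separately, and one of them is non-zero.\<close>

lemma eigenvalue_real:
  assumes ev: "eigenvalue (map_mat complex_of_real T) \<mu>"
  shows "eigenvalue T (Re \<mu>)" "Im \<mu> = 0" "0 \<le> Re \<mu>"
proof -
  show im: "Im \<mu> = 0" and "0 \<le> Re \<mu>" using spectrum_real_nonneg[OF ev] by auto
  obtain p q where pq: "p \<in> carrier_vec (n + (m + l))" "q \<in> carrier_vec (n + (m + l))"
      "p \<noteq> 0\<^sub>v (n + (m + l)) \<or> q \<noteq> 0\<^sub>v (n + (m + l))"
    and "T *\<^sub>v p = Re \<mu> \<cdot>\<^sub>v p + (- Im \<mu>) \<cdot>\<^sub>v q" "T *\<^sub>v q = Im \<mu> \<cdot>\<^sub>v p + Re \<mu> \<cdot>\<^sub>v q"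
    using complex_eigenvalue_real_parts[OF T_carrier ev] by metis
  then have "T *\<^sub>v p = Re \<mu> \<cdot>\<^sub>v p" "T *\<^sub>v q = Re \<mu> \<cdot>\<^sub>v q"
    unfolding im using pq(1,2) by (auto intro!: eq_vecI)
  then show "eigenvalue T (Re \<mu>)"
    using pq T_carrier unfolding eigenvalue_def eigenvector_def by auto
qed

section \<open>Rayleigh quotients, their minima and the eigenvalue bounds\<close>

abbreviation "X1 \<equiv> eigvec_blocks n m l T (- {1})"

lemma eigvec_blocks_iff:
  "x \<in> eigvec_blocks n m l T \<Lambda> \<longleftrightarrow>
    (\<exists>y z r. block_vec x y z \<and> r \<in> \<Lambda> \<and> eigenvector T (x @\<^sub>v y @\<^sub>v z) r)"
  unfolding eigvec_blocks_def by blast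

text \<open>On the kernel of \<open>C\<close> the \<open>CWC\<close> term drops out of both forms,
  so numerator and denominator are the \<open>E\<close> and \<open>G\<close> forms. The denominator
  is positive because \<open>x\<close> lies outside the kernel of \<open>B\<close> and is thus
  non-zero.\<close>

lemma eta_quotient:
  assumes x: "x \<in> carrier_vec n" and ker: "x \<in> mat_kernel C - mat_kernel B"
    and r: "r * (x \<bullet> (G *\<^sub>v x)) = x \<bullet> (E *\<^sub>v x)"
  shows "\<gamma> * (x \<bullet> (BQB *\<^sub>v x)) / (x \<bullet> ((A + \<gamma> \<cdot>\<^sub>m BQB) *\<^sub>v x)) = r"
proof -
  have Cx: "C *\<^sub>v x = 0\<^sub>v l" using mat_kernelD[OF C] ker by blast
  have Bx: "B *\<^sub>v x \<noteq> 0\<^sub>v m" using mat_kernelI[OF B x] ker by blast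
  have "x \<noteq> 0\<^sub>v n" using Bx mult_mat_zero_vec[OF B] by blast
  then have pos: "0 < x \<bullet> (G *\<^sub>v x)" using sym_pos_def_pos[OF G_spd x] by simp
  have E: "x \<bullet> (E *\<^sub>v x) = \<gamma> * (x \<bullet> (BQB *\<^sub>v x))"
    using x inv_W_carrier by (simp add: E_form CWC_form Cx mult_mat_zero_vec)
  have "A *\<^sub>v x \<in> carrier_vec n" "BQB *\<^sub>v x \<in> carrier_vec n"
    using mult_mat_vec_carrier[OF A_carrier x] mult_mat_vec_carrier[OF BQB_carrier x] .
  then have "x \<bullet> ((A + \<gamma> \<cdot>\<^sub>m BQB) *\<^sub>v x) = x \<bullet> (G *\<^sub>v x)"
    unfolding G_form[OF x x] E
    using x add_mult_distrib_mat_vec[OF A_carrier smult_carrier_mat[OF BQB_carrier] x]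
    by (simp only: smult_mat_mult_vec[OF BQB_carrier x] scalar_prod_add_distrib[of _ n]
        smult_carrier_vec scalar_prod_smult_distrib[of _ n])
  then show ?thesis using r pos E by (simp add: field_simps)
qed

lemma epsilon_quotient:
  assumes x: "x \<in> carrier_vec n" and ker: "x \<in> mat_kernel B - mat_kernel C"
    and r: "r * (x \<bullet> (G *\<^sub>v x)) = x \<bullet> (E *\<^sub>v x)"
  shows "\<delta> * (x \<bullet> (CWC *\<^sub>v x)) / (x \<bullet> ((A + \<delta> \<cdot>\<^sub>m CWC) *\<^sub>v x)) = r"
proof -
  have Bx: "B *\<^sub>v x = 0\<^sub>v m" using mat_kernelD[OF B] ker by blast
  have Cx: "C *\<^sub>v x \<noteq> 0\<^sub>v l" using mat_kernelI[OF C x] ker by blast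
  have "x \<noteq> 0\<^sub>v n" using Cx mult_mat_zero_vec[OF C] by blast
  then have pos: "0 < x \<bullet> (G *\<^sub>v x)" using sym_pos_def_pos[OF G_spd x] by simp
  have E: "x \<bullet> (E *\<^sub>v x) = \<delta> * (x \<bullet> (CWC *\<^sub>v x))"
    using x inv_Q_carrier by (simp add: E_form BQB_form Bx mult_mat_zero_vec)
  have "A *\<^sub>v x \<in> carrier_vec n" "CWC *\<^sub>v x \<in> carrier_vec n"
    using mult_mat_vec_carrier[OF A_carrier x] mult_mat_vec_carrier[OF CWC_carrier x] .
  then have "x \<bullet> ((A + \<delta> \<cdot>\<^sub>m CWC) *\<^sub>v x) = x \<bullet> (G *\<^sub>v x)"
    unfolding G_form[OF x x] E
    using x add_mult_distrib_mat_vec[OF A_carrier smult_carrier_mat[OF CWC_carrier] x]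
    by (simp only: smult_mat_mult_vec[OF CWC_carrier x] scalar_prod_add_distrib[of _ n]
        smult_carrier_vec scalar_prod_smult_distrib[of _ n])
  then show ?thesis using r pos E by (simp add: field_simps)
qed

lemma theta_quotient:
  assumes x: "x \<in> carrier_vec n" and ker: "x \<notin> mat_kernel B \<union> mat_kernel C"
    and r: "r * (x \<bullet> (G *\<^sub>v x)) = x \<bullet> (E *\<^sub>v x)"
  shows "(x \<bullet> (E *\<^sub>v x)) / (x \<bullet> (G *\<^sub>v x)) = r"
proof -
  have "x \<noteq> 0\<^sub>v n" using ker x mult_mat_zero_vec[OF B] mat_kernelI[OF B, of x] by auto
  then have "0 < x \<bullet> (G *\<^sub>v x)" using sym_pos_def_pos[OF G_spd x] by simp
  then show ?thesis using r by (simp add: field_simps)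
qed

text \<open>Each quotient equals the eigenvalue of the eigenvector that supplies \<open>x\<close>.
  This rests on \<open>eigenvector_rayleigh\<close>, hence the restriction to eigenvalues other than
  1.\<close>

lemma quotient_sets_subset:
  "eta_set X1 \<gamma> A B C Q \<union> epsilon_set X1 \<delta> A B C W \<union> theta_set X1 \<gamma> \<delta> A B C Q W
    \<subseteq> {r. eigenvalue T r}"
proof -
  have "\<exists>r. x \<in> carrier_vec n \<and> eigenvalue T r \<and> r * (x \<bullet> (G *\<^sub>v x)) = x \<bullet> (E *\<^sub>v x)"
    if "x \<in> X1" for x
    using that eigenvector_rayleigh unfolding eigvec_blocks_iff eigenvalue_def by blast
  then show ?thesis
    unfolding eta_set_def epsilon_set_def theta_set_def
    using eta_quotient epsilon_quotient theta_quotient by blast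
qed

text \<open>The spectrum of \<open>T\<close> is finite, so the minima in question are
  attained.\<close>

lemma quotient_sets_has_min:
  assumes "U \<subseteq> {r. eigenvalue T r}" "U \<noteq> {}"
  shows "has_min U"
proof -
  have "finite {r. eigenvalue T r}"
    using card_finite_spectrum(1)[OF T_carrier] unfolding spectrum_def .
  then have "finite U" using assms finite_subset by blast
  then show ?thesis
    unfolding has_min_def using assms by (intro bexI[of _ "Min U"]) auto
qed

lemma eigenvector_bounds:
  assumes ev: "eigenvector T (x @\<^sub>v y @\<^sub>v z) r" and v: "block_vec x y z"
    and r: "r \<noteq> 0" "r \<noteq> 1"
  shows "lower_bound X1 \<gamma> \<delta> A B C Q W \<le> ereal r" "r < 1"
proof -
  have x: "x \<in> carrier_vec n" and x0: "x \<noteq> 0\<^sub>v n"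
    using eigenvector_first_block_nonzero[OF ev v r(1)] v by auto
  have X: "x \<in> X1" using ev v r unfolding eigvec_blocks_iff by blast
  note ray = eigenvector_rayleigh[OF ev v r(2)]
  have pos: "0 < x \<bullet> (G *\<^sub>v x)" using sym_pos_def_pos[OF G_spd x x0] .
  have "r * (x \<bullet> (G *\<^sub>v x)) < 1 * (x \<bullet> (G *\<^sub>v x))"
    using sym_pos_def_pos[OF A x x0] G_form[OF x x] ray by simp
  then show "r < 1" using pos by simp
  \<comment> \<open>A vector in both kernels annihilates the \<open>E\<close> form and would give
    \<open>r = 0\<close>, so exactly three cases remain, one for each quotient set.\<close>
  have "\<not> (x \<in> mat_kernel B \<and> x \<in> mat_kernel C)"
  proof
    assume "x \<in> mat_kernel B \<and> x \<in> mat_kernel C"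
    then have "B *\<^sub>v x = 0\<^sub>v m" "C *\<^sub>v x = 0\<^sub>v l"
      using mat_kernelD[OF B] mat_kernelD[OF C] by blast+
    then have "x \<bullet> (E *\<^sub>v x) = 0"
      using x inv_Q_carrier inv_W_carrier
      by (simp add: E_form BQB_form CWC_form mult_mat_zero_vec)
    with ray pos r(1) show False by simp
  qed
  then consider "x \<in> mat_kernel C - mat_kernel B" | "x \<in> mat_kernel B - mat_kernel C"
    | "x \<notin> mat_kernel B \<union> mat_kernel C" by blast
  then have "r \<in> eta_set X1 \<gamma> A B C Q \<or> r \<in> epsilon_set X1 \<delta> A B C W
    \<or> r \<in> theta_set X1 \<gamma> \<delta> A B C Q W"
  proof cases
    case 1
    then show ?thesis
      unfolding eta_set_def using X eta_quotient[OF x 1 ray] by blast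
  next
    case 2
    then show ?thesis
      unfolding epsilon_set_def using X epsilon_quotient[OF x 2 ray] by blast
  next
    case 3
    then show ?thesis
      unfolding theta_set_def using X theta_quotient[OF x 3 ray] by blast
  qed
  then show "lower_bound X1 \<gamma> \<delta> A B C Q W \<le> ereal r"
    unfolding lower_bound_def ext_min_def by (auto simp: min_le_iff_disj intro: INF_lower)
qed

text \<open>For \<open>r = 1\<close> the lower bound needs some eigenvalue other than 0 and 1; without one all three
  sets would be empty and their minima infinite.\<close>

lemma eigenvalue_bounds:
  assumes ev: "eigenvalue T r" and r: "r \<noteq> 0"
  shows "lower_bound X1 \<gamma> \<delta> A B C Q W \<le> ereal r" "r \<le> 1"
proof -
  have "lower_bound X1 \<gamma> \<delta> A B C Q W \<le> ereal r \<and> r \<le> 1"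
  proof (cases "r = 1")
    case True
    obtain x y z r' where "block_vec x y z" "eigenvector T (x @\<^sub>v y @\<^sub>v z) r'" "r' \<noteq> 0" "r' \<noteq> 1"
      by (rule exists_eigenvector_not_0_1)
    then have "lower_bound X1 \<gamma> \<delta> A B C Q W \<le> ereal r'" "r' < 1"
      using eigenvector_bounds by auto
    moreover then have "ereal r' \<le> ereal 1" by simp
    ultimately show ?thesis using True order_trans by blast
  next
    case False
    obtain v where v: "eigenvector T v r" using ev unfolding eigenvalue_def by blast
    then have "v \<in> carrier_vec (n + (m + l))" using T_carrier unfolding eigenvector_def by auto
    then obtain x y z where "block_vec x y z" "v = x @\<^sub>v y @\<^sub>v z" using append_vec_cases3 by metis
    then show ?thesis using eigenvector_bounds v r False by (metis less_imp_le)
  qed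
  then show "lower_bound X1 \<gamma> \<delta> A B C Q W \<le> ereal r" "r \<le> 1" by auto
qed

text \<open>More vectors give more quotients and hence smaller infima. This carries the bound over
  \<open>X1\<close> to the weaker bound over all eigenvectors.\<close>

lemma lower_bound_mono:
  assumes "X \<subseteq> Y"
  shows "lower_bound Y \<gamma> \<delta> A B C Q W \<le> lower_bound X \<gamma> \<delta> A B C Q W"
proof -
  have "eta_set X \<gamma> A B C Q \<subseteq> eta_set Y \<gamma> A B C Q"
    "epsilon_set X \<delta> A B C W \<subseteq> epsilon_set Y \<delta> A B C W"
    "theta_set X \<gamma> \<delta> A B C Q W \<subseteq> theta_set Y \<gamma> \<delta> A B C Q W"
    using assms unfolding eta_set_def epsilon_set_def theta_set_def by blast+
  then show ?thesis
    unfolding lower_bound_def ext_min_def by (intro min.mono Inf_superset_mono image_mono)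
qed

text \<open>The multiplicity bound gives a root as soon as \<open>n > 0\<close>, and for
  \<open>n = 0\<close> the matrix \<open>C\<close> would have no columns and be zero.\<close>

lemma eigenvalue_one: "eigenvalue T 1"
proof -
  have "n \<noteq> 0"
  proof
    assume "n = 0"
    then have "C = 0\<^sub>m l n" using C by (intro eq_matI) auto
    with C_nz show False ..
  qed
  then have "Polynomial.order 1 (char_poly T) \<noteq> 0" using order_one_char_poly by simp
  then show ?thesis using order_root eigenvalue_root_char_poly[OF T_carrier] by blast
qed

end

text \<open>The inclusion is given for the first blocks of all eigenvectors (\<open>X\<close>) and,
  more sharply, for those of eigenvalues other than 1 (\<open>X1\<close>). Invertibility of the
  preconditioner is asserted because \<open>mat_inv\<close> is meaningful only then, and attainment
  is claimed for non-empty sets, as an empty one has the infinite minimum.\<close>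

theorem theorem3:
  fixes n m l :: nat and A B C Q W :: "real mat" and \<gamma> \<delta> :: real
  assumes "0 < l"
    and "sym_pos_def n A"
    and "B \<in> carrier_mat m n" and "vec_space.rank m B + 1 = m"
    and "C \<in> carrier_mat l n" and "vec_space.rank l C = l"
    and "sym_pos_def m Q" and "sym_pos_def l W"
    and "\<gamma> > 0" and "\<delta> > 0"
  shows "let T = precond_saddle_mat \<gamma> \<delta> A B C Q W;
             X = eigvec_blocks n m l T UNIV;
             X1 = eigvec_blocks n m l T (- {1})
         in invertible_mat (precond_mat \<gamma> \<delta> A B C Q W)
          \<and> (\<forall>\<mu> \<in> Spec T - {0}. \<mu> \<in> \<real> \<and> 0 < Re \<mu>)
          \<and> Spec T - {0} \<subseteq>
              complex_of_real ` {r. lower_bound X \<gamma> \<delta> A B C Q W \<le> ereal r \<and> r \<le> 1}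
          \<and> Spec T - {0} \<subseteq>
              complex_of_real ` {r. lower_bound X1 \<gamma> \<delta> A B C Q W \<le> ereal r \<and> r \<le> 1}
          \<and> (\<forall>S \<in> {eta_set X1 \<gamma> A B C Q, epsilon_set X1 \<delta> A B C W,
                      theta_set X1 \<gamma> \<delta> A B C Q W}. S \<noteq> {} \<longrightarrow> has_min S)
          \<and> eigenvalue T 1 \<and> n \<le> Polynomial.order 1 (char_poly T)"
proof -
  \<comment> \<open>The zero matrix has rank 0, whereas \<open>C\<close> has rank
    \<open>l > 0\<close>; this is how the rank of \<open>C\<close> enters the locale.\<close>
  have "vec_space.rank l (0\<^sub>m l n :: real mat) = 0" by (rule vec_space.rank_0I)
  then have "C \<noteq> 0\<^sub>m l n" using assms(1,6) by auto
  then interpret double_saddle_point n m l A B C Q W \<gamma> \<delta>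
    using assms by unfold_locales auto
  let ?X = "eigvec_blocks n m l T UNIV"
  have spec: "eigenvalue T (Re \<mu>)" "\<mu> = complex_of_real (Re \<mu>)" "0 < Re \<mu>"
    if "\<mu> \<in> Spec T - {0}" for \<mu>
  proof -
    from that have "eigenvalue (map_mat complex_of_real T) \<mu>" "\<mu> \<noteq> 0"
      by (auto simp: Spec_def spectrum_def)
    then show "eigenvalue T (Re \<mu>)" "\<mu> = complex_of_real (Re \<mu>)" "0 < Re \<mu>"
      using eigenvalue_real[of \<mu>] by (auto simp: complex_eq_iff)
  qed
  have X1: "Spec T - {0} \<subseteq>
      complex_of_real ` {r. lower_bound X1 \<gamma> \<delta> A B C Q W \<le> ereal r \<and> r \<le> 1}"
  proof
    fix \<mu> assume \<mu>: "\<mu> \<in> Spec T - {0}"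
    then have "Re \<mu> \<noteq> 0" using spec(3)[OF \<mu>] by simp
    then show "\<mu> \<in> complex_of_real ` {r. lower_bound X1 \<gamma> \<delta> A B C Q W \<le> ereal r \<and> r \<le> 1}"
      using eigenvalue_bounds[OF spec(1)[OF \<mu>]] spec(2)[OF \<mu>] by blast
  qed
  have "X1 \<subseteq> ?X" unfolding eigvec_blocks_def by blast
  then have "Spec T - {0} \<subseteq>
      complex_of_real ` {r. lower_bound ?X \<gamma> \<delta> A B C Q W \<le> ereal r \<and> r \<le> 1}"
    using X1 lower_bound_mono[of X1 ?X] order_trans by blast
  moreover have "\<forall>\<mu> \<in> Spec T - {0}. \<mu> \<in> \<real> \<and> 0 < Re \<mu>"
    using spec by (metis Reals_of_real)
  moreover have "\<forall>S \<in> {eta_set X1 \<gamma> A B C Q, epsilon_set X1 \<delta> A B C W,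
      theta_set X1 \<gamma> \<delta> A B C Q W}. S \<noteq> {} \<longrightarrow> has_min S"
    using quotient_sets_subset quotient_sets_has_min by blast
  ultimately show ?thesis
    using P_invertible X1 eigenvalue_one order_one_char_poly unfolding Let_def by blast
qed

end
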